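(* Let $X$ be a real Banach space, let $u\in S_X$ be a big point, and suppose there is a bicontractive linear projection $P: X\to[u]$ onto the span of $u$. Assume in addition that one of the following holds: (a) for every sequence $(x_n)\subset B_X$ with $\|u+x_n\|\to 2$ it holds that $P(x_n)\to u$ in norm; (b) the dual $X^*$ is $\omega^*$-LUR, i.e. for every $f\in S_{X^*}$ and every $(f_n)\subset B_{X^*}$ with $\|f+f_n\|\to 2$ one has $f_n\to f$ in the weak$^*$ topology. Then $X$ is isometrically a Hilbert space.
   Context: $\mathcal{G}_X$ is the group of surjective linear isometries of $X$ and $\mathcal{G}_X(x)=\{T(x):T\in\mathcal{G}_X\}$. A point $x\in S_X$ is a big point if $\overline{\mathrm{conv}}(\mathcal{G}_X(x))=B_X$. A linear projection $P$ is bicontractive if $\|P\|\le1$ and $\|I-P\|\le 1$. *)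

theory Defs
  imports "HOL-Analysis.Analysis"
begin

definition surj_lin_isometries :: "('a::real_normed_vector \<Rightarrow> 'a) set" where
  "surj_lin_isometries = {T. linear T \<and> surj T \<and> (\<forall>x. norm (T x) = norm x)}"

definition isometry_orbit :: "'a::real_normed_vector \<Rightarrow> 'a set" where
  "isometry_orbit x = {T x | T. T \<in> surj_lin_isometries}"

definition big_point :: "'a::real_normed_vector \<Rightarrow> bool" where
  "big_point x \<longleftrightarrow> norm x = 1 \<and> closure (convex hull (isometry_orbit x)) = cball 0 1"

definition bicontractive_projection :: "('a::real_normed_vector \<Rightarrow> 'a) \<Rightarrow> bool" where
  "bicontractive_projection P \<longleftrightarrow> linear P \<and> (\<forall>x. P (P x) = P x)
     \<and> (\<forall>x. norm (P x) \<le> norm x) \<and> (\<forall>x. norm (x - P x) \<le> norm x)"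

definition dual_wstar_LUR :: "'a::real_normed_vector itself \<Rightarrow> bool" where
  "dual_wstar_LUR _ \<longleftrightarrow>
     (\<forall>(f::'a \<Rightarrow>\<^sub>L real) (fs::nat \<Rightarrow> ('a \<Rightarrow>\<^sub>L real)).
        norm f = 1 \<longrightarrow> (\<forall>n. norm (fs n) \<le> 1) \<longrightarrow> (\<lambda>n. norm (f + fs n)) \<longlonglongrightarrow> 2 \<longrightarrow>
        (\<forall>x. (\<lambda>n. blinfun_apply (fs n) x) \<longlonglongrightarrow> blinfun_apply f x))"

text \<open>X is isometrically a Hilbert space (X is assumed complete): its norm is induced by an inner product.\<close>
definition norm_from_inner_product :: "'a::real_normed_vector itself \<Rightarrow> bool" where
  "norm_from_inner_product _ \<longleftrightarrow>
     (\<exists>ip :: 'a \<Rightarrow> 'a \<Rightarrow> real.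
        (\<forall>x y z. ip (x + y) z = ip x z + ip y z) \<and>
        (\<forall>r x y. ip (r *\<^sub>R x) y = r * ip x y) \<and>
        (\<forall>x y. ip x y = ip y x) \<and>
        (\<forall>x. ip x x = (norm x)\<^sup>2))"

end

theory Submission
  imports Defs
begin

text \<open>Write P x = f x u. For an isometry T the map taking y to y - f (inv T y) T u is contractive. A
  unit vector x is a limit of convex combinations of orbit points T u, and averaging these
  contractions shows that y - k y x has norm at most that of y for every functional k supporting the
  unit ball at x: Birkhoff orthogonality is symmetric. In dimension at least three this forces
  smoothness; the supporting functionals are then determined by their kernels, and comparing their
  slopes in three mutually orthogonal directions gives a multiplicative increasing involution of the
  positive reals, i.e. the identity, whence the Pythagorean theorem. In dimension two an invariant
  inner product exists, given by an ellipse of extremal area, and assumption (a) or (b) forces the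
  unit circle to be that ellipse.\<close>

section \<open>Supporting functionals\<close>

text \<open>Two obstacles shape the argument. Averaging needs \<open>f (inv T y)\<close> to be
  nearly the same number for all isometries \<open>T\<close> with \<open>k (T u)\<close> close to 1.
  Under (b) this number is \<open>k y\<close>, because \<open>f\<close> composed with
  \<open>inv T\<close> and \<open>k\<close> both almost attain their norm at \<open>T u\<close>.
  Under (a) the point x may a priori have many supporting functionals, and only the one-sided
  derivatives of the norm are within reach, by moving slightly from x towards y; \<open>k y\<close>
  lies between them, and a convexity argument covers it. The other obstacle is the dimension.
  Symmetric orthogonality also holds in Radon planes that are not Euclidean, so in the plane the
  isometry group has to be used a second time. In higher dimension a vector orthogonal to two given
  ones takes over.\<close>

definition sublinear :: "('a::real_vector \<Rightarrow> real) \<Rightarrow> bool" where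
  "sublinear q \<longleftrightarrow> (\<forall>x y. q (x + y) \<le> q x + q y) \<and> (\<forall>t\<ge>0. \<forall>x. q (t *\<^sub>R x) = t * q x)"

lemma sublinear_add: "sublinear q \<Longrightarrow> q (x + y) \<le> q x + q y"
  and sublinear_scale: "sublinear q \<Longrightarrow> t \<ge> 0 \<Longrightarrow> q (t *\<^sub>R x) = t * q x"
  by (auto simp: sublinear_def)

lemma sublinear_zero: "sublinear q \<Longrightarrow> q 0 = 0"
  using sublinear_scale[of q 0 0] by simp

lemma sublinear_minus: "sublinear q \<Longrightarrow> - q (- x) \<le> q x"
  using sublinear_add[of q x "- x"] sublinear_zero[of q] by simp

text \<open>Lower bounds of chains for Zorn's lemma. The value \<open>- p (- x)\<close> lies below
  every member and keeps the infimum finite; subadditivity survives because the smaller of two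
  members of a chain can serve in both terms.\<close>

lemma sublinear_INF_chain:
  assumes C: "C \<noteq> {}" "\<And>q. q \<in> C \<Longrightarrow> sublinear q \<and> (\<forall>x. q x \<le> p x)"
    and chain: "\<And>q r. q \<in> C \<Longrightarrow> r \<in> C \<Longrightarrow> (\<forall>x. q x \<le> r x) \<or> (\<forall>x. r x \<le> q x)"
  shows "sublinear (\<lambda>x. INF q\<in>C. q x)" "\<And>q x. q \<in> C \<Longrightarrow> (INF q\<in>C. q x) \<le> q x"
proof -
  have bdd: "bdd_below ((\<lambda>q. q x) ` C)" for x
  proof (rule bdd_belowI2)
    fix q assume "q \<in> C"
    then show "- p (- x) \<le> q x"
      using C(2)[of q] sublinear_minus[of q x] by (meson neg_le_iff_le order_trans)
  qed
  show le: "(INF q\<in>C. q x) \<le> q x" if "q \<in> C" for q x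
    using bdd that by (rule cINF_lower)
  have add: "(INF q\<in>C. q (x + y)) \<le> (INF q\<in>C. q x) + (INF q\<in>C. q y)" for x y
  proof -
    have "(INF q\<in>C. q (x + y)) \<le> q x + r y" if q: "q \<in> C" and r: "r \<in> C" for q r
    proof -
      obtain s where s: "s \<in> C" "\<forall>x. s x \<le> q x" "\<forall>x. s x \<le> r x"
        using chain[OF q r] q r by blast
      have "(INF q\<in>C. q (x + y)) \<le> s (x + y)" using le s by simp
      also have "\<dots> \<le> s x + s y" using C(2) s sublinear_add by blast
      also have "\<dots> \<le> q x + r y" using s by (simp add: add_mono)
      finally show ?thesis .
    qed
    then have "(INF q\<in>C. q (x + y)) - r y \<le> (INF q\<in>C. q x)" if "r \<in> C" for r
      using C(1) that by (intro cINF_greatest) (auto simp: algebra_simps)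
    then have "(INF q\<in>C. q (x + y)) - (INF q\<in>C. q x) \<le> (INF q\<in>C. q y)"
      using C(1) by (intro cINF_greatest) (auto simp: algebra_simps)
    then show ?thesis by simp
  qed
  have scale: "(INF q\<in>C. q (t *\<^sub>R x)) = t * (INF q\<in>C. q x)" if t: "t \<ge> 0" for t x
  proof (cases "t = 0")
    case True
    have "(\<lambda>q. q 0) ` C = {0::real}" using C sublinear_zero by (auto simp: image_iff)
    then show ?thesis using True by simp
  next
    case False
    then have t: "t > 0" using that by simp
    have eq: "q (t *\<^sub>R x) = t * q x" if "q \<in> C" for q
      using C(2) that t sublinear_scale[of q t x] by auto
    have "t * (INF q\<in>C. q x) \<le> (INF q\<in>C. q (t *\<^sub>R x))"
    proof (rule cINF_greatest[OF C(1)])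
      fix q assume "q \<in> C"
      then show "t * (INF q\<in>C. q x) \<le> q (t *\<^sub>R x)"
        using t le[of q x] eq[of q] by simp
    qed
    moreover have "(INF q\<in>C. q (t *\<^sub>R x)) / t \<le> (INF q\<in>C. q x)"
      using C(1) t eq le[of _ "t *\<^sub>R x"]
      by (intro cINF_greatest) (auto simp: field_simps)
    ultimately show ?thesis using t by (simp add: field_simps)
  qed
  show "sublinear (\<lambda>x. INF q\<in>C. q x)"
    unfolding sublinear_def using add scale by blast
qed

text \<open>The parameters 0 and 1 show that this lies below \<open>q\<close> and is at most
  \<open>- q a\<close> at \<open>- a\<close>: it is \<open>q\<close> pushed down until it is linear
  along \<open>a\<close>.\<close>

definition lower_at :: "('a::real_vector \<Rightarrow> real) \<Rightarrow> 'a \<Rightarrow> 'a \<Rightarrow> real" where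
  "lower_at q a x = (INF t\<in>{0..}. q (x + t *\<^sub>R a) - t * q a)"

lemma lower_at:
  assumes q: "sublinear q"
  shows lower_at_le: "t \<ge> 0 \<Longrightarrow> lower_at q a x \<le> q (x + t *\<^sub>R a) - t * q a"
    and sublinear_lower_at: "sublinear (lower_at q a)"
proof -
  have bdd: "bdd_below ((\<lambda>t. q (x + t *\<^sub>R a) - t * q a) ` {0..})" for x
  proof (rule bdd_belowI2)
    fix t :: real assume "t \<in> {0..}"
    then have "t * q a = q ((x + t *\<^sub>R a) + (- x))" using sublinear_scale[OF q, of t a] by simp
    also have "\<dots> \<le> q (x + t *\<^sub>R a) + q (- x)" by (rule sublinear_add[OF q])
    finally show "- q (- x) \<le> q (x + t *\<^sub>R a) - t * q a" by simp
  qed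
  show le: "lower_at q a x \<le> q (x + t *\<^sub>R a) - t * q a" if "t \<ge> 0" for x t
    unfolding lower_at_def using bdd that by (intro cINF_lower) auto
  have gr: "c \<le> lower_at q a x" if "\<And>t. t \<ge> 0 \<Longrightarrow> c \<le> q (x + t *\<^sub>R a) - t * q a" for c x
    unfolding lower_at_def using that by (intro cINF_greatest) auto
  have add: "lower_at q a (x + y) \<le> lower_at q a x + lower_at q a y" for x y
  proof -
    have 1: "lower_at q a (x + y) \<le> (q (x + s *\<^sub>R a) - s * q a) + (q (y + t *\<^sub>R a) - t * q a)"
      if "s \<ge> 0" "t \<ge> 0" for s t
      using le[of "s + t" "x + y"] that
        sublinear_add[OF q, of "x + s *\<^sub>R a" "y + t *\<^sub>R a"]
      by (simp add: algebra_simps)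
    have "lower_at q a (x + y) - (q (y + t *\<^sub>R a) - t * q a) \<le> lower_at q a x" if "t \<ge> 0" for t
      using 1 that by (intro gr) (auto simp: algebra_simps)
    then have "lower_at q a (x + y) - lower_at q a x \<le> lower_at q a y"
      by (intro gr) (auto simp: algebra_simps)
    then show ?thesis by simp
  qed
  have scale: "lower_at q a (c *\<^sub>R x) = c * lower_at q a x" if c: "c \<ge> 0" for c x
  proof (cases "c = 0")
    case True
    have "lower_at q a 0 \<le> 0" using le[of 0 0] sublinear_zero[OF q] by simp
    moreover have "0 \<le> lower_at q a 0"
      by (intro gr) (simp add: sublinear_scale[OF q])
    ultimately show ?thesis using True by simp
  next
    case False
    then have c: "c > 0" using that by simp
    have "c * lower_at q a x \<le> lower_at q a (c *\<^sub>R x)"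
    proof (rule gr)
      fix t :: real assume t: "t \<ge> 0"
      have "c * lower_at q a x \<le> c * (q (x + (t/c) *\<^sub>R a) - (t/c) * q a)"
        using le[of "t/c" x] t c by simp
      also have "\<dots> = q (c *\<^sub>R x + t *\<^sub>R a) - t * q a"
        using c sublinear_scale[OF q, of c "x + (t/c) *\<^sub>R a"] by (simp add: algebra_simps)
      finally show "c * lower_at q a x \<le> q (c *\<^sub>R x + t *\<^sub>R a) - t * q a" .
    qed
    moreover have "lower_at q a (c *\<^sub>R x) / c \<le> lower_at q a x"
    proof (rule gr)
      fix t :: real assume t: "t \<ge> 0"
      have "lower_at q a (c *\<^sub>R x) \<le> q (c *\<^sub>R x + (c*t) *\<^sub>R a) - (c*t) * q a"
        using le[of "c*t" "c *\<^sub>R x"] t c by simp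
      also have "\<dots> = c * (q (x + t *\<^sub>R a) - t * q a)"
        using c sublinear_scale[OF q, of c "x + t *\<^sub>R a"] by (simp add: algebra_simps)
      finally show "lower_at q a (c *\<^sub>R x) / c \<le> q (x + t *\<^sub>R a) - t * q a"
        using c by (simp add: field_simps)
    qed
    ultimately show ?thesis using c by (simp add: field_simps)
  qed
  show "sublinear (lower_at q a)" unfolding sublinear_def using add scale by blast
qed

text \<open>A pointwise minimal sublinear functional is linear, because it equals all its
  modifications \<^const>\<open>lower_at\<close>; Zorn's lemma provides such minimal functionals.\<close>

theorem Hahn_Banach_at_point:
  fixes p :: "'a::real_vector \<Rightarrow> real"
  assumes p: "sublinear p"
  obtains k where "linear k" "\<And>x. k x \<le> p x" "k y = p y"
proof -
  \<comment> \<open>Starting below \<open>lower_at p y\<close>, and not just below \<open>p\<close>,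
    yields \<open>k (- y) \<le> - p y\<close> and with it equality at \<open>y\<close>.\<close>
  define A where "A = {q. sublinear q \<and> (\<forall>x. q x \<le> lower_at p y x)}"
  have po: "partial_order_on A (relation_of (\<lambda>q r :: 'a \<Rightarrow> real. r \<le> q) A)"
    by (rule partial_order_on_relation_ofI) auto
  have "\<exists>m\<in>A. \<forall>q\<in>A. q \<le> m \<longrightarrow> q = m"
  proof (rule predicate_Zorn[OF po])
    fix C assume C: "C \<in> Chains (relation_of (\<lambda>q r :: 'a \<Rightarrow> real. r \<le> q) A)"
    have CA: "q \<in> A" if "q \<in> C" for q
      using C that by (auto simp: Chains_def relation_of_def)
    have ch: "(\<forall>x. q x \<le> r x) \<or> (\<forall>x. r x \<le> q x)" if "q \<in> C" "r \<in> C" for q r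
      using C that by (fastforce simp: Chains_def relation_of_def le_fun_def)
    show "\<exists>u\<in>A. \<forall>q\<in>C. u \<le> q"
    proof (cases "C = {}")
      case True
      have "lower_at p y \<in> A" using sublinear_lower_at[OF p] by (simp add: A_def)
      then show ?thesis using True by blast
    next
      case False
      have C2: "sublinear q \<and> (\<forall>x. q x \<le> lower_at p y x)" if "q \<in> C" for q
        using CA[OF that] by (simp add: A_def)
      have I: "sublinear (\<lambda>x. INF q\<in>C. q x)" "\<And>q x. q \<in> C \<Longrightarrow> (INF q\<in>C. q x) \<le> q x"
        by (rule sublinear_INF_chain[of C "lower_at p y"]; use False C2 ch in blast)+
      obtain q0 where q0: "q0 \<in> C" using False by blast
      have "(INF q\<in>C. q x) \<le> lower_at p y x" for x
        using I(2)[OF q0, of x] C2[OF q0] order_trans by blast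
      then have "(\<lambda>x. INF q\<in>C. q x) \<in> A"
        unfolding A_def using I(1) by blast
      then show ?thesis using I(2) by (intro bexI[of _ "\<lambda>x. INF q\<in>C. q x"]) (auto simp: le_fun_def)
    qed
  qed
  then obtain k where k: "k \<in> A" and min: "\<And>q. q \<in> A \<Longrightarrow> q \<le> k \<Longrightarrow> q = k" by blast
  have sub: "sublinear k" and kp: "\<And>x. k x \<le> lower_at p y x" using k by (auto simp: A_def)
  have low: "lower_at k a = k" for a
  proof (rule min)
    have *: "lower_at k a x \<le> k x" for x using lower_at_le[OF sub, of 0 a x] by simp
    then show "lower_at k a \<le> k" by (simp add: le_fun_def)
    show "lower_at k a \<in> A" unfolding A_def
      using sublinear_lower_at[OF sub] * kp order_trans by blast
  qed
  have add: "k (x + a) = k x + k a" for x a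
    using lower_at_le[OF sub, of 1 a x] sublinear_add[OF sub, of x a] by (simp add: low)
  have neg: "k (- x) = - k x" for x
    using add[of x "- x"] sublinear_zero[OF sub] by simp
  have "k (c *\<^sub>R x) = c * k x" for c x
    using sublinear_scale[OF sub, of c x] sublinear_scale[OF sub, of "- c" x] neg[of "c *\<^sub>R x"]
    by (cases "c \<ge> 0") auto
  then have lin: "linear k" using add by (intro linearI) auto
  have "k x \<le> p x" for x using kp[of x] lower_at_le[OF p, of 0 y x] by simp
  moreover have "k (- y) \<le> - p y"
    using kp[of "- y"] lower_at_le[OF p, of 1 y "- y"] sublinear_zero[OF p] by simp
  ultimately show thesis using lin neg that[of k] by (simp add: order_antisym)
qed

text \<open>By linearity the one-sided bound means operator norm at most 1. Normalising to
  \<open>norm x\<close> makes \<open>k\<close> insensitive to positive scaling of \<open>x\<close>;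
  every functional of norm at most 1 supports 0.\<close>

definition supports :: "('a::real_normed_vector \<Rightarrow> real) \<Rightarrow> 'a \<Rightarrow> bool" where
  "supports k x \<longleftrightarrow> linear k \<and> (\<forall>z. k z \<le> norm z) \<and> k x = norm x"

lemma supports_abs: "supports k x \<Longrightarrow> \<bar>k z\<bar> \<le> norm z"
  using linear_neg[of k z] norm_minus_cancel[of z]
  unfolding supports_def by (metis abs_le_iff)

lemma sublinear_norm: "sublinear (norm :: 'a::real_normed_vector \<Rightarrow> real)"
  by (auto simp: sublinear_def norm_triangle_ineq)

lemma supports_exists:
  obtains k where "supports k x"
  using Hahn_Banach_at_point[OF sublinear_norm, of x] unfolding supports_def by metis

text \<open>Hahn-Banach for the quotient seminorm by the line through \<open>x\<close>: it vanishes
  at \<open>x\<close> and \<open>- x\<close>, which forces \<open>k x = 0\<close>, and by assumption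
  it agrees with the norm at \<open>y\<close>.\<close>

lemma supports_orthogonal:
  assumes "\<And>t. norm y \<le> norm (y + t *\<^sub>R x)"
  obtains k where "supports k y" "k x = 0"
proof -
  define p where "p z = (INF t. norm (z + t *\<^sub>R x))" for z
  have le: "p z \<le> norm (z + t *\<^sub>R x)" for z t
    unfolding p_def by (intro cINF_lower bdd_belowI2[of _ 0]) auto
  have gr: "c \<le> p z" if "\<And>t. c \<le> norm (z + t *\<^sub>R x)" for c z
    unfolding p_def using that by (intro cINF_greatest) auto
  have "p (v + w) \<le> p v + p w" for v w
  proof -
    have "p (v + w) \<le> norm (v + s *\<^sub>R x) + norm (w + t *\<^sub>R x)" for s t
      using le[of "v + w" "s + t"] norm_triangle_ineq[of "v + s *\<^sub>R x" "w + t *\<^sub>R x"]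
      by (simp add: algebra_simps)
    then have "p (v + w) - norm (w + t *\<^sub>R x) \<le> p v" for t
      by (intro gr) (simp add: algebra_simps)
    then have "p (v + w) - p v \<le> p w"
      by (intro gr) (simp add: algebra_simps)
    then show ?thesis by simp
  qed
  moreover have "p (c *\<^sub>R v) = c * p v" if c: "c \<ge> 0" for c v
  proof (cases "c = 0")
    case True
    have "p 0 \<le> 0" using le[of 0 0] by simp
    moreover have "0 \<le> p 0" by (rule gr) simp
    ultimately show ?thesis using True by simp
  next
    case False
    then have c: "c > 0" using that by simp
    have *: "norm (c *\<^sub>R v + t *\<^sub>R x) = c * norm (v + (t / c) *\<^sub>R x)" for t
      using c norm_scaleR[of c "v + (t / c) *\<^sub>R x"] by (simp add: algebra_simps)
    have "c * p v \<le> p (c *\<^sub>R v)"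
      using c le by (intro gr) (simp add: *)
    moreover have "p (c *\<^sub>R v) / c \<le> p v"
      using c le[of "c *\<^sub>R v" "c * _"] by (intro gr) (simp add: * field_simps)
    ultimately show ?thesis using c by (simp add: field_simps)
  qed
  ultimately have p: "sublinear p" by (auto simp: sublinear_def)
  obtain k where k: "linear k" "\<And>z. k z \<le> p z" "k y = p y" using Hahn_Banach_at_point[OF p] by blast
  have "p y = norm y" using le[of y 0] gr[of "norm y" y] assms by (simp add: order_antisym)
  moreover have "k z \<le> norm z" for z using k(2)[of z] le[of z 0] by simp
  moreover have "k x \<le> 0" using k(2)[of x] le[of x "-1"] by simp
  moreover have "k (- x) \<le> 0" using k(2)[of "- x"] le[of "- x" 1] by simp
  ultimately show thesis using k that[of k] by (auto simp: supports_def linear_neg)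
qed

section \<open>Symmetric orthogonality implies smoothness\<close>

lemma supports_linear: "supports k x \<Longrightarrow> linear k"
  and supports_le: "supports k x \<Longrightarrow> k z \<le> norm z"
  and supports_self: "supports k x \<Longrightarrow> k x = norm x"
  by (auto simp: supports_def)

lemma supports_scale: "supports k x \<Longrightarrow> t \<ge> 0 \<Longrightarrow> supports k (t *\<^sub>R x)"
  by (simp add: supports_def linear_scale)

lemma supports_sum:
  assumes "supports k x" "supports k y"
  shows "supports k (x + y)"
proof -
  have "norm (x + y) \<le> k (x + y)"
    using assms by (simp add: supports_def linear_add norm_triangle_ineq)
  then show ?thesis using assms(1) by (simp add: supports_def order_antisym)
qed

text \<open>Birkhoff orthogonality of \<open>x\<close> to \<open>y\<close> is expressed by a
  functional supporting at \<open>x\<close> and vanishing at \<open>y\<close>; the conclusion is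
  orthogonality of \<open>y\<close> to \<open>x\<close> in its metric form.\<close>

definition symmetric_orthogonality :: "'a::real_normed_vector itself \<Rightarrow> bool" where
  "symmetric_orthogonality _ \<longleftrightarrow>
     (\<forall>k (x::'a) y t. supports k x \<longrightarrow> k y = 0 \<longrightarrow> norm y \<le> norm (y + t *\<^sub>R x))"

text \<open>Three independent vectors may sit in a larger space, so the meaning is dimension at
  least three, infinite dimension included.\<close>

definition three_dimensional :: "'a::real_vector itself \<Rightarrow> bool" where
  "three_dimensional _ \<longleftrightarrow> (\<exists>B :: 'a set. independent B \<and> card B = 3)"

lemma common_kernel:
  fixes k0 k1 :: "'a::real_vector \<Rightarrow> real"
  assumes dim: "three_dimensional TYPE('a)" and lin: "linear k0" "linear k1"
  obtains b where "b \<noteq> 0" "k0 b = 0" "k1 b = 0"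
proof (rule ccontr)
  assume *: "\<not> thesis"
  note ex = that
  have inj0: "b = 0" if "k0 b = 0" "k1 b = 0" for b
    using * ex[of b] that by blast
  define L where "L x = (k0 x, k1 x)" for x
  have L: "linear L"
    using lin by (auto simp: L_def linear_iff)
  have inj: "inj L"
    using inj0 by (simp add: linear_injective_0[OF L] L_def zero_prod_def)
  obtain B :: "'a set" where B: "independent B" "card B = 3"
    using dim by (auto simp: three_dimensional_def)
  have "independent (L ` B)"
    using linear_independent_injective_image[OF L B(1)] inj by (simp add: inj_on_subset)
  then have "card (L ` B) \<le> DIM(real \<times> real)"
    using independent_bound by blast
  moreover have "card (L ` B) = card B"
    using inj by (intro card_image) (rule inj_on_subset[OF _ subset_UNIV])
  ultimately show False using B by simp
qed

lemma symmetric_orthogonality_supports: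
  fixes x :: "'a::real_normed_vector"
  assumes "symmetric_orthogonality TYPE('a)" "supports k x" "k y = 0"
  obtains k' where "supports k' y" "k' x = 0"
  using supports_orthogonal[of y x] assms unfolding symmetric_orthogonality_def by blast

text \<open>The vector on the left lies in the kernel of \<open>k\<close>, so symmetry makes it a
  point of least norm on the line through \<open>y\<close> in direction \<open>x\<close>.\<close>

lemma symmetric_orthogonality_project:
  fixes x :: "'a::real_normed_vector"
  assumes sym: "symmetric_orthogonality TYPE('a)" and k: "supports k x" and x: "x \<noteq> 0"
  shows "norm (y - (k y / norm x) *\<^sub>R x) \<le> norm (y + t *\<^sub>R x)"
proof -
  have "k (y - (k y / norm x) *\<^sub>R x) = 0"
    using k x by (simp add: supports_def linear_diff linear_scale)
  then have "norm (y - (k y / norm x) *\<^sub>R x) \<le> norm (y - (k y / norm x) *\<^sub>R x + (t + k y / norm x) *\<^sub>R x)"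
    using sym k unfolding symmetric_orthogonality_def by blast
  then show ?thesis by (simp add: algebra_simps)
qed

text \<open>The functional \<open>g\<close> also supports both end points of the segment. Tilt
  \<open>z\<close> inside the kernel of \<open>g\<close> to \<open>z'\<close>. A functional
  supporting at \<open>z'\<close> and vanishing at the end point \<open>m + z/2\<close> is negative
  at \<open>m\<close>, so projecting \<open>m\<close> along \<open>z'\<close> moves it strictly
  without increasing its norm, and \<open>g\<close> supports there too. A conical combination with
  the other end point cancels \<open>z\<close> and leaves a displacement in direction
  \<open>b\<close>.\<close>

lemma ruled_cone_step:
  fixes z m b :: "'a::real_normed_vector"
  assumes sym: "symmetric_orthogonality TYPE('a)"
    and z: "z \<noteq> 0" and g: "supports g m" and m: "m \<noteq> 0"
    and np: "norm (m + (1/2) *\<^sub>R z) = norm m" and nm: "norm (m - (1/2) *\<^sub>R z) = norm m"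
    and sgn: "\<bar>\<sigma>\<bar> = (1::real)"
  obtains r where "r > 0" "supports g (m + (\<sigma> * r) *\<^sub>R b)"
proof -
  have lg: "linear g" using g by (rule supports_linear)
  have g_le: "g v \<le> norm v" for v using g by (rule supports_le)
  have gz: "g z = 0"
    using g_le[of "m + (1/2) *\<^sub>R z"] g_le[of "m - (1/2) *\<^sub>R z"] np nm supports_self[OF g]
    by (simp add: linear_add[OF lg] linear_diff[OF lg] linear_scale[OF lg])
  have gp: "supports g (m + (1/2) *\<^sub>R z)" and gm: "supports g (m - (1/2) *\<^sub>R z)"
    using g np nm gz by (simp_all add: supports_def linear_add linear_diff linear_scale)
  define \<beta> where "\<beta> = g b / norm m"
  define b' where "b' = b - \<beta> *\<^sub>R m"
  \<comment> \<open>This size keeps the tilt below a quarter of \<open>norm z\<close>, which gives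
    \<open>k z > 0\<close> below; the 1 in the denominator covers \<open>b' = 0\<close>, and
    \<sigma> chooses the side.\<close>
  define \<epsilon> where "\<epsilon> = \<sigma> * (norm z / (4 * (norm b' + 1)))"
  define z' where "z' = z + \<epsilon> *\<^sub>R b'"
  have gb': "g b' = 0"
    using m supports_self[OF g] by (simp add: b'_def \<beta>_def linear_diff[OF lg] linear_scale[OF lg])
  have gz': "g z' = 0"
    using gz gb' by (simp add: z'_def linear_add[OF lg] linear_scale[OF lg])
  have pos: "norm b' + 1 > 0" by (simp add: add_nonneg_pos)
  have \<epsilon>: "\<epsilon> \<noteq> 0" "\<epsilon> = \<sigma> * \<bar>\<epsilon>\<bar>" using z sgn pos by (auto simp: \<epsilon>_def abs_mult)
  have small: "norm (\<epsilon> *\<^sub>R b') \<le> norm z / 4"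
  proof -
    have "norm (\<epsilon> *\<^sub>R b') = norm z / 4 * (norm b' / (norm b' + 1))"
      using sgn pos by (simp add: \<epsilon>_def abs_mult)
    also have "\<dots> \<le> norm z / 4 * 1"
      using pos by (intro mult_left_mono) auto
    finally show ?thesis by simp
  qed
  have nz': "norm z' \<ge> 3/4 * norm z"
    using small norm_triangle_ineq2[of z "- (\<epsilon> *\<^sub>R b')"] by (simp add: z'_def)
  then have z': "z' \<noteq> 0" using z by auto
  obtain k where k: "supports k z'" "k (m + (1/2) *\<^sub>R z) = 0"
    using symmetric_orthogonality_supports[OF sym gp gz'] .
  have lk: "linear k" using k(1) by (rule supports_linear)
  have "k z = norm z' - k (\<epsilon> *\<^sub>R b')"
    using supports_self[OF k(1)] linear_add[OF lk, of z "\<epsilon> *\<^sub>R b'"] by (simp add: z'_def)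
  then have kz: "k z > 0"
  proof -
    have "norm z > 0" using z by simp
    then show ?thesis using supports_le[OF k(1), of "\<epsilon> *\<^sub>R b'"] small nz' \<open>k z = _\<close> by linarith
  qed
  define \<tau> where "\<tau> = - k m / norm z'"
  have km: "k m = - k z / 2" using k(2) by (simp add: linear_add[OF lk] linear_scale[OF lk])
  have \<tau>: "\<tau> > 0" using km kz z' by (simp add: \<tau>_def)
  have "norm (m + \<tau> *\<^sub>R z') \<le> norm m"
    using symmetric_orthogonality_project[OF sym k(1) z', of m 0] by (simp add: \<tau>_def)
  moreover have "g (m + \<tau> *\<^sub>R z') = norm m"
    using gz' supports_self[OF g] by (simp add: linear_add[OF lg] linear_scale[OF lg])
  ultimately have w1: "supports g (m + \<tau> *\<^sub>R z')"
    using g g_le[of "m + \<tau> *\<^sub>R z'"] by (simp add: supports_def)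
  \<comment> \<open>The weight \<open>2 * \<tau>\<close> below cancels the multiple of
    \<open>z\<close>; the summand \<open>c *\<^sub>R m\<close> makes \<kappa>, the resulting
    coefficient of \<open>m\<close>, positive.\<close>
  define c where "c = \<bar>\<tau> * \<epsilon> * \<beta>\<bar>"
  define \<kappa> where "\<kappa> = 1 + 2 * \<tau> - \<tau> * \<epsilon> * \<beta> + c"
  have \<kappa>: "\<kappa> > 0" using \<tau> by (simp add: \<kappa>_def c_def)
  have "supports g ((m + \<tau> *\<^sub>R z') + (2 * \<tau>) *\<^sub>R (m - (1/2) *\<^sub>R z) + c *\<^sub>R m)"
    using \<tau> by (intro supports_sum[OF supports_sum[OF w1]] supports_scale gm g) (auto simp: c_def)
  then have "supports g ((1 / \<kappa>) *\<^sub>R ((m + \<tau> *\<^sub>R z') + (2 * \<tau>) *\<^sub>R (m - (1/2) *\<^sub>R z) + c *\<^sub>R m))"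
    using \<kappa> by (intro supports_scale) auto
  also have "(m + \<tau> *\<^sub>R z') + (2 * \<tau>) *\<^sub>R (m - (1/2) *\<^sub>R z) + c *\<^sub>R m = \<kappa> *\<^sub>R m + (\<tau> * \<epsilon>) *\<^sub>R b"
    by (simp add: \<kappa>_def z'_def b'_def algebra_simps)
  also have "(1 / \<kappa>) *\<^sub>R (\<kappa> *\<^sub>R m + (\<tau> * \<epsilon>) *\<^sub>R b) = m + (\<sigma> * (\<tau> * \<bar>\<epsilon>\<bar> / \<kappa>)) *\<^sub>R b"
    using \<kappa> \<epsilon>(2) by (simp add: scaleR_add_right algebra_simps)
  finally show thesis using \<tau> \<epsilon>(1) \<kappa> by (intro that[of "\<tau> * \<bar>\<epsilon>\<bar> / \<kappa>"]) auto
qed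

lemma convex_on_line_between:
  fixes p z :: "'a::real_normed_vector"
  assumes eq: "norm (p - z) = norm p" and min: "\<And>t. norm p \<le> norm (p + t *\<^sub>R z)" and t: "0 \<le> t" "t \<le> 1"
  shows "norm (p - t *\<^sub>R z) = norm p"
proof (rule order_antisym)
  have "p - t *\<^sub>R z = (1 - t) *\<^sub>R p + t *\<^sub>R (p - z)" by (simp add: algebra_simps)
  then have "norm (p - t *\<^sub>R z) \<le> norm ((1 - t) *\<^sub>R p) + norm (t *\<^sub>R (p - z))"
    by (metis norm_triangle_ineq)
  also have "\<dots> = (1 - t) * norm p + t * norm p" using eq t by simp
  also have "\<dots> = norm p" by (simp add: algebra_simps)
  finally show "norm (p - t *\<^sub>R z) \<le> norm p" .
  show "norm p \<le> norm (p - t *\<^sub>R z)" using min[of "- t"] by simp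
qed

text \<open>If z had two supporting functionals, the unit sphere would contain segments in
  direction z along a whole line of points m s; by symmetry of orthogonality these segments
  thicken to flat pieces with a common supporting functional g, so that the norm would be linear
  along that line.\<close>

theorem unique_support:
  fixes z :: "'a::real_normed_vector"
  assumes sym: "symmetric_orthogonality TYPE('a)" and dim: "three_dimensional TYPE('a)"
    and z: "z \<noteq> 0" and k0: "supports k0 z" and k1: "supports k1 z"
  shows "k0 = k1"
proof (rule ccontr)
  assume "k0 \<noteq> k1"
  then obtain a0 where a0: "k0 a0 \<noteq> k1 a0" by blast
  note l0 = supports_linear[OF k0] and l1 = supports_linear[OF k1]
  have nz: "norm z > 0" using z by simp
  \<comment> \<open>On the line through \<open>a + s b\<close> in direction \<open>z\<close> the
    norm is minimal at \<open>a + s b\<close> because of \<open>k0\<close> and at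
    \<open>a + s b - z\<close> because of \<open>k1\<close>, hence constant in between. The scaling
    of \<open>a\<close> puts the second point into the kernel of \<open>k1\<close>.\<close>
  define a where "a = (norm z / (k1 a0 - k0 a0)) *\<^sub>R (a0 - (k0 a0 / norm z) *\<^sub>R z)"
  have a: "k0 a = 0" "k1 a = norm z"
    using a0 nz supports_self[OF k0] supports_self[OF k1]
    by (simp_all add: a_def linear_scale[OF l0] linear_diff[OF l0] linear_scale[OF l1] linear_diff[OF l1])
  obtain b where b: "b \<noteq> 0" "k0 b = 0" "k1 b = 0"
    using common_kernel[OF dim l0 l1] .
  define p where "p s = a + s *\<^sub>R b" for s
  define m where "m s = p s - (1/2) *\<^sub>R z" for s
  have k0p: "k0 (p s) = 0" and k1p: "k1 (p s) = norm z" for s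
    using a b by (simp_all add: p_def linear_scale[OF l0] linear_add[OF l0] linear_scale[OF l1] linear_add[OF l1])
  have min0: "norm (p s) \<le> norm (p s + t *\<^sub>R z)" for s t
    using sym k0 k0p unfolding symmetric_orthogonality_def by blast
  have "k1 (p s - z) = 0" for s
    using k1p supports_self[OF k1] by (simp add: linear_diff[OF l1])
  then have min1: "norm (p s - z) \<le> norm (p s - z + t *\<^sub>R z)" for s t
    using sym k1 unfolding symmetric_orthogonality_def by blast
  have eq: "norm (p s - z) = norm (p s)" for s
    using min0[of s "-1"] min1[of s 1] by simp
  have seg: "norm (p s - t *\<^sub>R z) = norm (p s)" if "0 \<le> t" "t \<le> 1" for s t
    using convex_on_line_between[OF eq min0 that] .
  have nm: "norm (m s) = norm (p s)" for s using seg[of "1/2" s] by (simp add: m_def)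
  have m1: "norm (m s + (1/2) *\<^sub>R z) = norm (m s)" for s
    using nm by (simp add: m_def)
  have m2: "norm (m s - (1/2) *\<^sub>R z) = norm (m s)" for s
    using nm eq[of s] by (simp add: m_def scaleR_left_distrib[symmetric] diff_diff_eq)
  have m0: "m s \<noteq> 0" for s
  proof -
    have "p s \<noteq> 0" using k1p[of s] nz linear_0[OF l1] by auto
    then show ?thesis using nm[of s] by auto
  qed
  have mm: "m s + r *\<^sub>R b = m (s + r)" for s r by (simp add: m_def p_def algebra_simps)
  have m_eq: "m s = m 0 + s *\<^sub>R b" for s using mm[of 0 s] by simp
  obtain g where g: "supports g (m 0)" by (rule supports_exists)
  note lg = supports_linear[OF g]
  define Z where "Z = {s. supports g (m s)}"
  have Z_eq: "Z = {s. g a - g z / 2 + s * g b = norm (m s)}"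
    using g unfolding Z_def supports_def
    by (auto simp: m_def p_def linear_add[OF lg] linear_diff[OF lg] linear_scale[OF lg] algebra_simps)
  have "closed Z" unfolding Z_eq m_def p_def
    by (intro closed_Collect_eq continuous_intros)
  moreover have "open Z"
  proof (rule openI)
    fix s assume "s \<in> Z"
    then have s: "supports g (m s)" by (simp add: Z_def)
    obtain r where r: "r > 0" "supports g (m s + (1 * r) *\<^sub>R b)"
      using ruled_cone_step[OF sym z s m0 m1 m2, of 1 b] by auto
    obtain q where q: "q > 0" "supports g (m s + (-1 * q) *\<^sub>R b)"
      using ruled_cone_step[OF sym z s m0 m1 m2, of "-1" b] by auto
    have "x \<in> Z" if x: "s - q < x" "x < s + r" for x
    proof -
      define w where "w = (x - (s - q)) / (r + q)"
      have w: "0 \<le> w" "w \<le> 1" using x r q by (auto simp: w_def)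
      have "supports g (w *\<^sub>R m (s + r) + (1 - w) *\<^sub>R m (s - q))"
        using w r(2) q(2) by (intro supports_sum supports_scale) (auto simp: mm mm[of s "- q", simplified])
      also have "w *\<^sub>R m (s + r) + (1 - w) *\<^sub>R m (s - q) = m (s - q + w * (r + q))"
        unfolding m_eq[of "s + r"] m_eq[of "s - q"] m_eq[of "s - q + w * (r + q)"]
        by (simp add: algebra_simps)
      also have "s - q + w * (r + q) = x" using r q by (simp add: w_def)
      finally show ?thesis by (simp add: Z_def)
    qed
    then have "ball s (min q r) \<subseteq> Z" by (auto simp: dist_real_def)
    then show "\<exists>e>0. ball s e \<subseteq> Z" using r q by (intro exI[of _ "min q r"]) auto
  qed
  moreover have "0 \<in> Z" using g by (simp add: Z_def)
  ultimately have Z: "Z = UNIV" using clopen by blast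
  have lin: "norm (m s) = g a - g z / 2 + s * g b" for s
  proof -
    have "s \<in> Z" by (simp add: Z)
    then show ?thesis by (simp add: Z_eq)
  qed
  \<comment> \<open>The norms of \<open>m s\<close> and \<open>m (- s)\<close> have constant sum,
    yet the distance of these points grows with \<open>s\<close>.\<close>
  have bound: "s * norm b \<le> g a - g z / 2" if s: "s \<ge> 0" for s
  proof -
    have "norm (m s) + norm (m (- s)) = 2 * (g a - g z / 2)"
      using lin[of s] lin[of "- s"] by simp
    moreover have "norm (m s - m (- s)) = 2 * (s * norm b)"
    proof -
      have "m s - m (- s) = (2 * s) *\<^sub>R b"
        unfolding m_eq[of s] m_eq[of "- s"] by (simp add: algebra_simps flip: scaleR_2)
      then show ?thesis using s by simp
    qed
    ultimately show ?thesis using norm_triangle_ineq4[of "m s" "m (- s)"] by simp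
  qed
  define C where "C = g a - g z / 2"
  have "C \<ge> 0" using bound[of 0] by (simp add: C_def)
  then show False using bound[of "(C + 1) / norm b"] b(1) by (simp add: C_def)
qed

section \<open>Smooth spaces with symmetric orthogonality\<close>

text \<open>\<open>h\<close> chooses a supporting functional at each point; away from 0 the choice
  is forced by \<open>unique_support\<close>. It is constant along open rays, unlike the usual
  duality map, which scales with the vector.\<close>

locale duality_map =
  fixes h :: "'a::real_normed_vector \<Rightarrow> 'a \<Rightarrow> real"
  assumes supports_h: "supports (h x) x"
    and symmetric: "symmetric_orthogonality TYPE('a)"
    and dim3: "three_dimensional TYPE('a)"
begin

lemma linear_h: "linear (h x)"
  and h_le: "h x z \<le> norm z"
  and h_self: "h x x = norm x"
  using supports_h[of x] by (auto simp: supports_def)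

lemmas h_simps = linear_add[OF linear_h] linear_diff[OF linear_h] linear_scale[OF linear_h]
  linear_neg[OF linear_h] linear_0[OF linear_h]

lemma h_unique: "x \<noteq> 0 \<Longrightarrow> supports k x \<Longrightarrow> k = h x"
  using unique_support[OF symmetric dim3 _ _ supports_h] .

lemma orthogonal_nonzero: "x \<noteq> 0 \<Longrightarrow> h x y = 0 \<Longrightarrow> x + y \<noteq> 0"
  using h_self[of x] linear_add[OF linear_h, of x x y] linear_0[OF linear_h, of x] by auto

lemma h_sym:
  assumes "y \<noteq> 0" "h x y = 0" shows "h y x = 0"
proof -
  obtain k where "supports k y" "k x = 0"
    using symmetric_orthogonality_supports[OF symmetric supports_h assms(2)] .
  then show ?thesis using h_unique[OF assms(1)] by simp
qed

text \<open>Evaluate \<open>h y\<close> at the projection of \<open>y\<close> along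
  \<open>x\<close>, whose norm is at most \<open>norm y\<close>.\<close>

lemma h_sign:
  assumes "x \<noteq> 0" shows "h x y * h y x \<ge> 0"
proof -
  have "norm y - h x y / norm x * h y x \<le> norm (y - (h x y / norm x) *\<^sub>R x)"
    using h_le[of y "y - (h x y / norm x) *\<^sub>R x"] by (simp add: h_simps h_self)
  also have "\<dots> \<le> norm y"
    using symmetric_orthogonality_project[OF symmetric supports_h assms, of y 0] by simp
  finally show ?thesis using assms by (simp add: zero_le_divide_iff)
qed

text \<open>The vector \<open>w\<close> lies in the plane of \<open>x\<close> and \<open>y\<close>
  and in the kernel of \<open>h u\<close>. By symmetry \<open>h w\<close> vanishes at
  \<open>u\<close> and at \<open>z\<close>, hence by linearity at \<open>v\<close>, and symmetry
  again gives \<open>h v w = 0\<close>: on that plane \<open>h v\<close> and \<open>h u\<close> are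
  proportional.\<close>

lemma h_proportional:
  assumes xz: "h x z = 0" and yz: "h y z = 0" and z: "z \<noteq> 0"
    and u: "u = a *\<^sub>R x + b *\<^sub>R y" and v: "v = d *\<^sub>R u + e *\<^sub>R z" "v \<noteq> 0"
  shows "h u y * h v x = h u x * h v y"
proof -
  define w where "w = h u y *\<^sub>R x - h u x *\<^sub>R y"
  have "h v w = 0"
  proof (cases "w = 0")
    case False
    have "h u w = 0" by (simp add: w_def h_simps)
    then have wu: "h w u = 0" using h_sym[OF False] by blast
    have "h z w = 0" using h_sym[OF z xz] h_sym[OF z yz] by (simp add: w_def h_simps)
    then have "h w z = 0" using h_sym[OF False] by blast
    then have "h w v = 0" using wu by (simp add: v h_simps)
    then show ?thesis using h_sym[OF v(2)] by blast
  qed (simp add: h_simps)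
  then show ?thesis by (simp add: w_def h_simps)
qed

text \<open>It records the kernel, within the plane, of the functional supporting at
  \<open>x + s y\<close>. For orthogonal vectors of an inner product space it would be
  \<open>s * (norm y)\<^sup>2 / (norm x)\<^sup>2\<close>.\<close>

definition slope :: "'a \<Rightarrow> 'a \<Rightarrow> real \<Rightarrow> real" where
  "slope x y s = h (x + s *\<^sub>R y) y / h (x + s *\<^sub>R y) x"

lemma h_pos:
  assumes x: "x \<noteq> 0" and y: "h x y = 0"
  shows "h (x + s *\<^sub>R y) x > 0"
proof -
  let ?v = "x + s *\<^sub>R y"
  have 1: "h x ?v = norm x" using y by (simp add: h_simps h_self)
  have "?v \<noteq> 0" using orthogonal_nonzero[OF x, of "s *\<^sub>R y"] y by (simp add: h_simps)
  then have "h ?v x \<noteq> 0" using h_sym[OF x, of ?v] 1 x by auto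
  moreover have "h ?v x \<ge> 0" using h_sign[OF x, of ?v] 1 x by (simp add: zero_le_mult_iff)
  ultimately show ?thesis by simp
qed

lemma slope_pos:
  assumes x: "x \<noteq> 0" and y: "y \<noteq> 0" "h x y = 0" and s: "s > 0"
  shows "slope x y s > 0"
proof -
  have yx: "h y x = 0" using h_sym[OF y] .
  have "h (y + (1/s) *\<^sub>R x) y > 0" using h_pos[OF y(1) yx] .
  have "h (x + s *\<^sub>R y) = h (y + (1/s) *\<^sub>R x)"
  proof (rule h_unique)
    show "y + (1 / s) *\<^sub>R x \<noteq> 0"
      using orthogonal_nonzero[OF y(1), of "(1 / s) *\<^sub>R x"] yx by (simp add: h_simps)
    have "(1/s) *\<^sub>R (x + s *\<^sub>R y) = y + (1/s) *\<^sub>R x" using s by (simp add: algebra_simps)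
    then show "supports (h (x + s *\<^sub>R y)) (y + (1/s) *\<^sub>R x)"
      using supports_scale[OF supports_h[of "x + s *\<^sub>R y"], of "1/s"] s by simp
  qed
  then show ?thesis using h_pos[OF x y(2), of s] \<open>h (y + (1/s) *\<^sub>R x) y > 0\<close> by (simp add: slope_def)
qed

lemma slope_neg:
  assumes "x \<noteq> 0" "y \<noteq> 0" "h x y = 0" "s < 0"
  shows "slope x y s < 0"
  using slope_pos[of x "- y" "- s"] assms by (simp add: slope_def h_simps)

text \<open>The subgradient inequalities at the two points show that the value at \<open>y\<close>
  of the supporting functional does not decrease and its value at \<open>x\<close> does not
  increase.\<close>

lemma slope_mono:
  assumes x: "x \<noteq> 0" and y: "y \<noteq> 0" "h x y = 0" and s: "0 < s" "s < t"
  shows "slope x y s \<le> slope x y t"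
proof -
  let ?s = "x + s *\<^sub>R y" and ?t = "x + t *\<^sub>R y"
  define p q p' q' where d: "p = h ?s x" "q = h ?s y" "p' = h ?t x" "q' = h ?t y"
  have 1: "p + t * q \<le> p' + t * q'" using h_le[of ?s ?t] h_self[of ?t] by (simp add: h_simps d)
  have 2: "p' + s * q' \<le> p + s * q" using h_le[of ?t ?s] h_self[of ?s] by (simp add: h_simps d)
  have "(t - s) * q \<le> (t - s) * q'" using 1 2 by (simp add: algebra_simps)
  then have q: "q \<le> q'" using s by simp
  then have "s * q \<le> s * q'" using s by simp
  then have "p' \<le> p" using 2 by linarith
  moreover have "p' > 0" using h_pos[OF x y(2)] by (simp add: d)
  moreover have "q > 0"
    using slope_pos[OF x y s(1)] h_pos[OF x y(2), of s] by (simp add: slope_def d zero_less_divide_iff)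
  ultimately show ?thesis using q unfolding slope_def d[symmetric] by (intro frac_le) auto
qed

text \<open>Choose \<open>z\<close> orthogonal to both. At \<open>x + s y + s t z\<close> the ratios
  of the values of the supporting functional are slopes in the three coordinate planes, by
  \<open>h_proportional\<close>; this factors \<open>slope x z (s * t)\<close>. Eliminating
  \<open>z\<close> by instances with \<open>s = 1\<close> or \<open>t = 1\<close> leaves
  multiplicativity up to the constant \<open>slope x y 1\<close>.\<close>

lemma slope_mult:
  assumes x: "x \<noteq> 0" and y: "y \<noteq> 0" "h x y = 0"
    and st: "s \<noteq> 0" "t \<noteq> 0"
  shows "slope x y (s * t) * slope x y 1 = slope x y s * slope x y t"
proof -
  obtain z where z: "z \<noteq> 0" "h x z = 0" "h y z = 0"
    using common_kernel[OF dim3 linear_h linear_h] .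
  have yx: "h y x = 0" and zx: "h z x = 0" and zy: "h z y = 0"
    using h_sym y z by auto
  have *: "slope x z (s * t) = slope x y s * slope y z t" if st: "s \<noteq> 0" "t \<noteq> 0" for s t
  proof -
    let ?v = "x + s *\<^sub>R y + (s * t) *\<^sub>R z"
    let ?u = "x + s *\<^sub>R y"
    have v: "?v \<noteq> 0"
      using orthogonal_nonzero[OF x, of "s *\<^sub>R y + (s * t) *\<^sub>R z"] y z by (simp add: h_simps add.assoc)
    have 1: "h ?u y * h ?v x = h ?u x * h ?v y"
      by (rule h_proportional[OF z(2,3) z(1) _ _ v, of _ 1 s 1 "s * t"]) simp_all
    have 2: "h (x + (s*t) *\<^sub>R z) z * h ?v x = h (x + (s*t) *\<^sub>R z) x * h ?v z"
      by (rule h_proportional[OF y(2) zy y(1) _ _ v, of _ 1 "s * t" 1 s]) (simp_all add: algebra_simps)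
    have 3: "h (y + t *\<^sub>R z) z * h ?v y = h (y + t *\<^sub>R z) y * h ?v z"
      by (rule h_proportional[OF yx zx x _ _ v, of _ 1 t s 1]) (simp_all add: algebra_simps)
    have px: "h ?v x > 0"
    proof -
      have "h x (y + t *\<^sub>R z) = 0" using y z by (simp add: h_simps)
      from h_pos[OF x this, of s] show ?thesis by (simp add: algebra_simps)
    qed
    have a: "slope x y s = h ?v y / h ?v x"
      using 1 px h_pos[OF x y(2), of s] by (simp add: slope_def field_simps)
    have b: "slope x z (s * t) = h ?v z / h ?v x"
      using 2 px h_pos[OF x z(2), of "s * t"] by (simp add: slope_def field_simps)
    have "slope x y s \<noteq> 0" using slope_pos[OF x y] slope_neg[OF x y] st by (metis less_irrefl linorder_neqE)
    then have vy: "h ?v y \<noteq> 0" using a by auto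
    have c: "slope y z t = h ?v z / h ?v y"
      using 3 vy h_pos[OF y(1) z(3), of t] by (simp add: slope_def field_simps)
    show ?thesis using a b c vy by simp
  qed
  have nz: "slope y z 1 \<noteq> 0" using slope_pos[OF y(1) z(1,3), of 1] by simp
  have "(slope x y (s * t) * slope x y 1) * slope y z 1 = slope x z (s * t) * slope x y 1"
    using *[of "s * t" 1] st by simp
  also have "\<dots> = slope x y s * (slope x y 1 * slope y z t)"
    using *[OF st] by simp
  also have "slope x y 1 * slope y z t = slope x y t * slope y z 1"
    using *[of 1 t] *[of t 1] st by simp
  finally show ?thesis using nz by simp
qed

text \<open>Within the plane, \<open>x - y / slope x y s\<close> spans the kernel of the functional
  at \<open>x + s y\<close>. Symmetry exchanges the two vectors, so each determines the slope at the
  other.\<close>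

lemma slope_inverse:
  assumes x: "x \<noteq> 0" and y: "y \<noteq> 0" "h x y = 0" and s: "s \<noteq> 0"
  shows "slope x y (- (1 / slope x y s)) = - (1 / s)"
proof -
  let ?r = "slope x y s"
  have r: "?r \<noteq> 0" using slope_pos[OF x y] slope_neg[OF x y] s by (metis less_irrefl linorder_neqE)
  let ?v = "x + s *\<^sub>R y" and ?w = "x + (- (1 / ?r)) *\<^sub>R y"
  have px: "h ?v x > 0" "h ?w x > 0" using h_pos[OF x y(2)] by blast+
  have hy: "h ?v y = ?r * h ?v x" using px by (simp add: slope_def)
  have "h ?v ?w = 0" using r hy by (simp add: h_simps)
  moreover have "?w \<noteq> 0"
    using orthogonal_nonzero[OF x, of "(- (1 / ?r)) *\<^sub>R y"] y(2) by (simp add: h_simps)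
  ultimately have "h ?w ?v = 0" using h_sym by blast
  then have "h ?w x + s * h ?w y = 0" by (simp add: h_simps)
  then have "h ?w y = - (1 / s) * h ?w x" using s by (simp add: field_simps)
  then show ?thesis using px(2) by (simp add: slope_def)
qed

lemma slope_linear:
  assumes x: "x \<noteq> 0" and y: "y \<noteq> 0" "h x y = 0"
  shows "slope x y s = slope x y 1 * s"
proof -
  define C where "C = slope x y 1"
  define m where "m s = slope x y s / C" for s
  have C: "C > 0" using slope_pos[OF x y, of 1] by (simp add: C_def)
  have m_mult: "m (s * t) = m s * m t" if "s \<noteq> 0" "t \<noteq> 0" for s t
    using slope_mult[OF x y that] C by (simp add: m_def C_def field_simps)
  have m1: "m 1 = 1" using C by (simp add: m_def C_def)
  have mpos: "m s > 0" if "s > 0" for s using slope_pos[OF x y that] C by (simp add: m_def)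
  have mneg: "m (-1) = -1"
  proof -
    have "m (-1) * m (-1) = 1" using m_mult[of "-1" "-1"] m1 by simp
    moreover have "m (-1) < 0" using slope_neg[OF x y, of "-1"] C by (simp add: m_def divide_neg_pos)
    ultimately show ?thesis by (metis abs_minus_cancel abs_of_neg abs_mult_self_eq abs_one abs_square_eq_1 minus_minus power2_eq_square)
  qed
  have minv: "m (1 / t) = 1 / m t" if "t > 0" for t
    using m_mult[of t "1 / t"] m1 that mpos[of t] by (simp add: field_simps)
  \<comment> \<open>This is \<open>slope_inverse\<close> with signs and reciprocals moved out of
    \<open>m\<close> by multiplicativity. The case \<open>s = 1\<close> gives
    \<open>m C = C\<close>, so \<open>m\<close> is an involution.\<close>
  have mm: "m (m s) * m C = C * s" if s: "s > 0" for s
  proof -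
    have "m (- (1 / (C * m s))) = - (1 / (C * s))"
      using slope_inverse[OF x y, of s] s C by (simp add: m_def)
    moreover have "m (- (1 / (C * m s))) = - (1 / (m C * m (m s)))"
      using m_mult[of "-1" "1 / (C * m s)"] minv[of "C * m s"] m_mult[of C "m s"] mneg C mpos[OF s] by simp
    ultimately have "m C * m (m s) = C * s" using C s mpos[OF C] mpos[OF mpos[OF s]] by simp
    then show ?thesis by (simp add: mult.commute)
  qed
  have mC: "m C = C" using mm[of 1] m1 by simp
  then have inv: "m (m s) = s" if "s > 0" for s using mm[OF that] C by simp
  have mono: "m s \<le> m t" if "0 < s" "s < t" for s t
    using slope_mono[OF x y that] C by (simp add: m_def divide_right_mono)
  \<comment> \<open>If \<open>s < m s\<close>, monotonicity gives
    \<open>m s \<le> m (m s) = s\<close>, a contradiction; the case \<open>m s < s\<close> is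
    similar.\<close>
  have pos: "m s = s" if s: "s > 0" for s
    using mono[of s "m s"] mono[of "m s" s] inv[OF s] mpos[OF s] s by linarith
  have "m s = s"
  proof (cases s "0::real" rule: linorder_cases)
    case less
    then show ?thesis using m_mult[of "-1" "- s"] mneg pos[of "- s"] by simp
  next
    case equal
    have "h x y = 0" by (rule y)
    then show ?thesis using equal by (simp add: m_def slope_def)
  qed (rule pos)
  then show ?thesis using C by (simp add: m_def C_def field_simps)
qed

text \<open>Linearity of the slope determines the derivative
  \<open>C * s * \<phi> s / (1 + C * s\<^sup>2)\<close> of the norm \<phi> along the line, so
  \<open>(\<phi> s)\<^sup>2 / (1 + C * s\<^sup>2)\<close> is constant.\<close>

lemma norm_along_orthogonal:
  assumes x: "x \<noteq> 0" and y: "y \<noteq> 0" "h x y = 0"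
  obtains C where "\<And>s. (norm (x + s *\<^sub>R y))\<^sup>2 = (norm x)\<^sup>2 * (1 + C * s\<^sup>2)"
proof -
  define C where "C = slope x y 1"
  define \<phi> where "\<phi> s = norm (x + s *\<^sub>R y)" for s
  define q where "q s = C * s * \<phi> s / (1 + C * s\<^sup>2)" for s
  have "C > 0" using slope_pos[OF x y, of 1] by (simp add: C_def)
  then have den: "1 + C * s\<^sup>2 > 0" for s by (simp add: add_pos_nonneg)
  have q: "h (x + s *\<^sub>R y) y = q s" for s
  proof -
    have 1: "h (x + s *\<^sub>R y) y = C * s * h (x + s *\<^sub>R y) x"
      using slope_linear[OF x y, of s] h_pos[OF x y(2), of s] by (simp add: slope_def[of x y s] C_def field_simps)
    have "\<phi> s = h (x + s *\<^sub>R y) x + s * h (x + s *\<^sub>R y) y"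
      using h_self[of "x + s *\<^sub>R y"] by (simp add: h_simps \<phi>_def)
    then have "\<phi> s = h (x + s *\<^sub>R y) x * (1 + C * s\<^sup>2)"
      using 1 by (simp add: algebra_simps power2_eq_square)
    then show ?thesis using 1 den[of s] by (simp add: q_def)
  qed
  have sub: "\<phi> s + (t - s) * q s \<le> \<phi> t" for s t
    using h_le[of "x + s *\<^sub>R y" "x + t *\<^sub>R y"] h_self[of "x + s *\<^sub>R y"]
    by (simp add: h_simps q \<phi>_def algebra_simps)
  have cont: "isCont q s" for s
    unfolding q_def \<phi>_def using den[of s] by (intro continuous_intros) auto
  \<comment> \<open>The two subgradient inequalities put the difference quotient between
    \<open>q s\<close> and \<open>q t\<close>, and \<open>q\<close> is continuous.\<close>
  have deriv: "(\<phi> has_field_derivative q s) (at s)" for s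
    unfolding has_field_derivative_iff
  proof (rule LIM_zero_cancel, rule Lim_null_comparison)
    show "\<forall>\<^sub>F t in at s. norm ((\<phi> t - \<phi> s) / (t - s) - q s) \<le> \<bar>q t - q s\<bar>"
    proof (rule eventually_mono[OF eventually_neq_at_within[of s]])
      fix t assume "t \<noteq> s"
      then show "norm ((\<phi> t - \<phi> s) / (t - s) - q s) \<le> \<bar>q t - q s\<bar>"
      proof (cases "t > s")
        case True
        have "q s \<le> (\<phi> t - \<phi> s) / (t - s)" "(\<phi> t - \<phi> s) / (t - s) \<le> q t"
          using True sub[of s t] sub[of t s] by (simp_all add: field_simps)
        then show ?thesis by simp
      next
        case False
        then have "t < s" using \<open>t \<noteq> s\<close> by simp
        then have "q t \<le> (\<phi> t - \<phi> s) / (t - s)" "(\<phi> t - \<phi> s) / (t - s) \<le> q s"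
          using sub[of s t] sub[of t s] by (simp_all add: field_simps)
        then show ?thesis by simp
      qed
    qed
    have "(\<lambda>t. \<bar>q t - q s\<bar>) \<midarrow>s\<rightarrow> \<bar>q s - q s\<bar>"
      using cont[of s] unfolding isCont_def by (intro tendsto_intros)
    then show "(\<lambda>t. \<bar>q t - q s\<bar>) \<midarrow>s\<rightarrow> 0" by simp
  qed
  define F where "F s = (\<phi> s)\<^sup>2 / (1 + C * s\<^sup>2)" for s
  have "(F has_field_derivative 0) (at s)" for s
  proof -
    have *: "1 + C * s\<^sup>2 \<noteq> 0" using den[of s] by simp
    have "2 * \<phi> s * q s * (1 + C * s\<^sup>2) - (\<phi> s)\<^sup>2 * (C * (2 * s)) = 0"
      using * by (simp add: q_def power2_eq_square)
    then show ?thesis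
      unfolding F_def using * by (auto intro!: derivative_eq_intros deriv simp: power2_eq_square algebra_simps)
  qed
  then have "F s = F 0" for s using DERIV_isconst_all by blast
  then have "(\<phi> s)\<^sup>2 = (\<phi> 0)\<^sup>2 * (1 + C * s\<^sup>2)" for s
  proof -
    have "(\<phi> s)\<^sup>2 / (1 + C * s\<^sup>2) = (\<phi> 0)\<^sup>2" using \<open>F s = F 0\<close> by (simp add: F_def)
    then show ?thesis using den[of s] by (simp add: divide_eq_eq)
  qed
  then show thesis using that[of C] by (simp add: \<phi>_def)
qed

text \<open>The constants obtained from \<open>x\<close> and from \<open>y\<close> are related by
  computing the norms of \<open>x + y\<close> and \<open>y + 2 x\<close> in both ways; these two
  linear equations give \<open>(norm x)\<^sup>2 = (norm y)\<^sup>2 * D\<close>.\<close>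

lemma pythagoras:
  assumes xy: "h x y = 0" and x: "x \<noteq> 0"
  shows "(norm (a *\<^sub>R x + y))\<^sup>2 = a\<^sup>2 * (norm x)\<^sup>2 + (norm y)\<^sup>2"
proof (cases "y = 0")
  case False
  have yx: "h y x = 0" using h_sym[OF False xy] .
  obtain C where C: "\<And>s. (norm (x + s *\<^sub>R y))\<^sup>2 = (norm x)\<^sup>2 * (1 + C * s\<^sup>2)"
    using norm_along_orthogonal[OF x False xy] by blast
  obtain D where D: "\<And>s. (norm (y + s *\<^sub>R x))\<^sup>2 = (norm y)\<^sup>2 * (1 + D * s\<^sup>2)"
    using norm_along_orthogonal[OF False x yx] by blast
  have 1: "(norm x)\<^sup>2 * (1 + C) = (norm y)\<^sup>2 * (1 + D)"
    using C[of 1] D[of 1] by (simp add: add.commute)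
  have "y + 2 *\<^sub>R x = 2 *\<^sub>R (x + (1/2) *\<^sub>R y)" by (simp add: algebra_simps)
  then have "norm (y + 2 *\<^sub>R x) = 2 * norm (x + (1/2) *\<^sub>R y)" by simp
  then have 2: "4 * ((norm x)\<^sup>2 * (1 + C / 4)) = (norm y)\<^sup>2 * (1 + 4 * D)"
    using C[of "1/2"] D[of 2] by (simp add: power2_eq_square)
  have "(norm x)\<^sup>2 = (norm y)\<^sup>2 * D" using 1 2 by (simp add: algebra_simps)
  then show ?thesis using D[of a] by (simp add: algebra_simps)
qed (simp add: power_mult_distrib)

theorem inner_product: "norm_from_inner_product TYPE('a)"
proof -
  \<comment> \<open>Polarisation makes symmetry evident; the formula \<open>norm y * h y x\<close>,
    found by splitting \<open>x\<close> along \<open>y\<close>, makes linearity in \<open>x\<close>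
    evident.\<close>
  define ip :: "'a \<Rightarrow> 'a \<Rightarrow> real" where "ip x y = ((norm (x + y))\<^sup>2 - (norm (x - y))\<^sup>2) / 4" for x y
  have ip: "ip x y = norm y * h y x" for x y
  proof (cases "y = 0")
    case False
    define a where "a = h y x / norm y"
    define x' where "x' = x - a *\<^sub>R y"
    have "h y x' = 0" using False by (simp add: x'_def a_def h_simps h_self)
    note P = pythagoras[OF this False]
    have "x + y = (a + 1) *\<^sub>R y + x'" "x - y = (a - 1) *\<^sub>R y + x'" by (simp_all add: x'_def algebra_simps)
    then have "ip x y = ((a + 1)\<^sup>2 - (a - 1)\<^sup>2) * (norm y)\<^sup>2 / 4"
      unfolding ip_def by (simp only: P) (simp add: algebra_simps)
    also have "\<dots> = a * (norm y)\<^sup>2" by (simp add: power2_eq_square algebra_simps)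
    also have "\<dots> = norm y * h y x" using False by (simp add: a_def power2_eq_square)
    finally show ?thesis .
  qed (simp add: ip_def)
  have "ip x y = ip y x" for x y by (simp add: ip_def norm_minus_commute add.commute)
  moreover have "ip x x = (norm x)\<^sup>2" for x by (simp add: ip h_self power2_eq_square)
  ultimately show ?thesis unfolding norm_from_inner_product_def
    by (intro exI[of _ ip]) (auto simp: ip h_simps algebra_simps)
qed

end

theorem symmetric_orthogonality_inner_product:
  assumes "symmetric_orthogonality TYPE('a::real_normed_vector)" "three_dimensional TYPE('a)"
  shows "norm_from_inner_product TYPE('a)"
proof -
  have "\<exists>k. supports k x" for x :: 'a by (metis supports_exists)
  then obtain h where "\<And>x :: 'a. supports (h x) x" by metis
  then interpret duality_map h using assms by unfold_locales
  show ?thesis by (rule inner_product)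
qed

section \<open>Big points and averaged projections\<close>

lemma isometry_linear: "T \<in> surj_lin_isometries \<Longrightarrow> linear T"
  and isometry_norm: "T \<in> surj_lin_isometries \<Longrightarrow> norm (T x) = norm x"
  by (auto simp: surj_lin_isometries_def)

lemma isometry_bij:
  assumes "T \<in> surj_lin_isometries" shows "bij T"
proof -
  have "inj T" using linear_injective_0[OF isometry_linear[OF assms]] isometry_norm[OF assms]
    by (metis norm_eq_zero)
  then show ?thesis using assms by (simp add: surj_lin_isometries_def bij_def)
qed

lemma isometry_inv_right: "T \<in> surj_lin_isometries \<Longrightarrow> T (inv T x) = x"
  and isometry_inv_left: "T \<in> surj_lin_isometries \<Longrightarrow> inv T (T x) = x"
  using isometry_bij[of T] by (auto simp: bij_def surj_f_inv_f)

lemma isometry_inv: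
  assumes T: "T \<in> surj_lin_isometries" shows "inv T \<in> surj_lin_isometries"
proof -
  note lin = isometry_linear[OF T] and r = isometry_inv_right[OF T] and l = isometry_inv_left[OF T]
  have "inv T (x + y) = inv T x + inv T y" for x y
    using l[of "inv T x + inv T y"] by (simp add: linear_add[OF lin] r)
  moreover have "inv T (c *\<^sub>R x) = c *\<^sub>R inv T x" for c x
    using l[of "c *\<^sub>R inv T x"] by (simp add: linear_scale[OF lin] r)
  moreover have "norm (inv T x) = norm x" for x
    using isometry_norm[OF T, of "inv T x"] by (simp add: r)
  moreover have "surj (inv T)" using isometry_bij[OF T] by (simp add: bij_imp_bij_inv bij_is_surj)
  ultimately show ?thesis by (auto simp: surj_lin_isometries_def intro: linearI)
qed

lemma functional_bounded_linear:
  fixes k :: "'a::real_normed_vector \<Rightarrow> real"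
  assumes "linear k" "\<And>z. k z \<le> norm z" shows "bounded_linear k"
proof (rule bounded_linear_intro[where K=1])
  show "norm (k x) \<le> norm x * 1" for x
    using assms(2)[of x] assms(2)[of "- x"] linear_neg[OF assms(1), of x] by simp
qed (use assms(1) in \<open>auto simp: linear_add linear_scale\<close>)

locale big_point_functional =
  fixes u :: "'a::real_normed_vector" and f :: "'a \<Rightarrow> real"
  assumes big: "big_point u"
    and linear_f: "linear f" and f_u: "f u = 1"
    and f_abs_le: "\<bar>f x\<bar> \<le> norm x" and complement_le: "norm (x - f x *\<^sub>R u) \<le> norm x"
begin

lemmas f_simps = linear_add[OF linear_f] linear_diff[OF linear_f] linear_scale[OF linear_f]
  linear_neg[OF linear_f] linear_0[OF linear_f]

lemma norm_u: "norm u = 1" using big by (simp add: big_point_def)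

lemma norm_orbit: "T \<in> surj_lin_isometries \<Longrightarrow> norm (T u) = 1"
  by (simp add: isometry_norm norm_u)

text \<open>The form in which the big point assumption is used: \<open>C\<close> will be a
  half-space, an ellipse, or a sublevel set of a penalised norm.\<close>

lemma unit_ball_subset:
  assumes "closed C" "convex C" "\<And>T. T \<in> surj_lin_isometries \<Longrightarrow> T u \<in> C" "norm x \<le> 1"
  shows "x \<in> C"
proof -
  have "closure (convex hull (isometry_orbit u)) \<subseteq> C"
    using assms by (intro closure_minimal hull_minimal) (auto simp: isometry_orbit_def)
  then show ?thesis using big assms(4) by (auto simp: big_point_def)
qed

text \<open>Otherwise the half-space \<open>k \<le> c\<close> would contain the orbit and hence the
  unit ball.\<close>

lemma orbit_exceeds:
  assumes k: "bounded_linear k" and "norm x \<le> 1" "k x > (c::real)"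
  obtains T where "T \<in> surj_lin_isometries" "k (T u) > c"
proof (rule ccontr)
  assume "\<not> thesis"
  then have le: "k (T u) \<le> c" if "T \<in> surj_lin_isometries" for T using that(1) \<open>\<And>T. \<lbrakk>T \<in> surj_lin_isometries; c < k (T u)\<rbrakk> \<Longrightarrow> thesis\<close> by force
  have "x \<in> {p. k p \<le> c}"
  proof (rule unit_ball_subset)
    show "closed {p. k p \<le> c}"
      by (intro closed_Collect_le continuous_intros linear_continuous_on k)
    show "convex {p. k p \<le> c}"
      using convex_linear_vimage[OF bounded_linear.linear[OF k], of "{..c}"] by (simp add: vimage_def)
  qed (use le assms in auto)
  then show False using assms(3) by simp
qed

text \<open>The complementary projection conjugated by \<open>T\<close>.\<close>

lemma complement_orbit_le:
  assumes T: "T \<in> surj_lin_isometries"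
  shows "norm (x - f (inv T x) *\<^sub>R T u) \<le> norm x"
proof -
  note lin = isometry_linear[OF T]
  have "norm (x - f (inv T x) *\<^sub>R T u) = norm (T (inv T x - f (inv T x) *\<^sub>R u))"
    by (simp add: linear_diff[OF lin] linear_scale[OF lin] isometry_inv_right[OF T])
  also have "\<dots> \<le> norm (inv T x)"
    using complement_le by (simp add: isometry_norm[OF T])
  finally show ?thesis by (simp add: isometry_norm[OF isometry_inv[OF T]])
qed

lemma f_inv_abs_le: "T \<in> surj_lin_isometries \<Longrightarrow> \<bar>f (inv T x)\<bar> \<le> norm x"
  using f_abs_le[of "inv T x"] by (simp add: isometry_norm isometry_inv)

text \<open>Writing x as a limit of convex combinations of orbit points T u, the corresponding
  combinations of contractive complementary projections tend to y - c x on y. The penalty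
  term M (1 - k p) makes the set of p below contain all orbit points.\<close>
lemma averaged_projection:
  assumes k: "supports k x" and x: "norm x = 1" and \<eta>: "\<eta> > 0" and \<epsilon>: "\<epsilon> \<ge> 0"
    and near: "\<And>T. T \<in> surj_lin_isometries \<Longrightarrow> k (T u) > 1 - \<eta> \<Longrightarrow> \<bar>f (inv T y) - c\<bar> \<le> \<epsilon>"
  shows "norm (y - c *\<^sub>R x) \<le> norm y + \<epsilon>"
proof -
  \<comment> \<open>If \<open>1 - k (T u) \<ge> \<eta>\<close>, the penalty is at least
    \<open>\<bar>c\<bar>\<close>, which is what the triangle inequality costs; at \<open>x\<close>
    the penalty vanishes.\<close>
  define M where "M = \<bar>c\<bar> / \<eta>"
  have M: "M \<ge> 0" using \<eta> by (simp add: M_def)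
  note lk = supports_linear[OF k]
  have bk: "bounded_linear k" using functional_bounded_linear[OF lk supports_le[OF k]] .
  let ?C = "{p. norm (y - c *\<^sub>R p) \<le> norm y + \<epsilon> + M * (1 - k p)}"
  have "x \<in> ?C"
  proof (rule unit_ball_subset)
    show "closed ?C"
      by (intro closed_Collect_le continuous_intros linear_continuous_on bk)
    show "convex ?C"
      unfolding convex_def
    proof (intro ballI allI impI, simp, goal_cases)
      case (1 p q v w)
      have "y - c *\<^sub>R (v *\<^sub>R p + w *\<^sub>R q) = (v + w) *\<^sub>R y - c *\<^sub>R (v *\<^sub>R p + w *\<^sub>R q)" using 1 by simp
      also have "\<dots> = v *\<^sub>R (y - c *\<^sub>R p) + w *\<^sub>R (y - c *\<^sub>R q)" by (simp add: algebra_simps)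
      finally have "norm (y - c *\<^sub>R (v *\<^sub>R p + w *\<^sub>R q)) \<le> v * norm (y - c *\<^sub>R p) + w * norm (y - c *\<^sub>R q)"
        using 1 norm_triangle_ineq[of "v *\<^sub>R (y - c *\<^sub>R p)" "w *\<^sub>R (y - c *\<^sub>R q)"] by simp
      also have "\<dots> \<le> v * (norm y + \<epsilon> + M * (1 - k p)) + w * (norm y + \<epsilon> + M * (1 - k q))"
        using 1 by (intro add_mono mult_left_mono) auto
      also have "\<dots> = (v + w) * (norm y + \<epsilon> + M) - M * (v * k p + w * k q)"
        by (simp add: algebra_simps)
      also have "\<dots> = norm y + \<epsilon> + M * (1 - k (v *\<^sub>R p + w *\<^sub>R q))"
        using 1 by (simp add: linear_add[OF lk] linear_scale[OF lk] algebra_simps)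
      finally show ?case .
    qed
    show "T u \<in> ?C" if T: "T \<in> surj_lin_isometries" for T
    proof (cases "k (T u) > 1 - \<eta>")
      case True
      have "y - c *\<^sub>R T u = (y - f (inv T y) *\<^sub>R T u) + (f (inv T y) - c) *\<^sub>R T u"
        by (simp add: algebra_simps)
      then have "norm (y - c *\<^sub>R T u)
          \<le> norm (y - f (inv T y) *\<^sub>R T u) + norm ((f (inv T y) - c) *\<^sub>R T u)"
        by (metis norm_triangle_ineq)
      also have "\<dots> \<le> norm y + norm ((f (inv T y) - c) *\<^sub>R T u)"
        using complement_orbit_le[OF T, of y] by simp
      also have "\<dots> \<le> norm y + \<epsilon>" using near[OF T True] norm_orbit[OF T] by simp
      also have "\<dots> \<le> norm y + \<epsilon> + M * (1 - k (T u))"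
        using supports_le[OF k, of "T u"] norm_orbit[OF T] M by simp
      finally show ?thesis by simp
    next
      case False
      have "norm (y - c *\<^sub>R T u) \<le> norm y + \<bar>c\<bar>"
        using norm_triangle_ineq4[of y "c *\<^sub>R T u"] norm_orbit[OF T] by simp
      also have "\<bar>c\<bar> = M * \<eta>" using \<eta> by (simp add: M_def)
      also have "norm y + M * \<eta> \<le> norm y + M * (1 - k (T u))"
        using False M by (simp add: mult_left_mono)
      finally show ?thesis using \<epsilon> by simp
    qed
  qed (simp add: x)
  then show ?thesis using supports_self[OF k] x by simp
qed

text \<open>Averaging runs over all isometries at once, so the sequential condition is replaced by
  one with a modulus \<eta>.\<close>

lemma uniform_detection:
  assumes det: "\<And>xs :: nat \<Rightarrow> 'a. (\<And>n. norm (xs n) \<le> 1) \<Longrightarrow> (\<lambda>n. norm (u + xs n)) \<longlonglongrightarrow> 2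
            \<Longrightarrow> (\<lambda>n. f (xs n)) \<longlonglongrightarrow> 1"
    and \<epsilon>: "\<epsilon> > 0"
  obtains \<eta> where "\<eta> > 0" "\<And>x. norm x \<le> 1 \<Longrightarrow> norm (u + x) > 2 - \<eta> \<Longrightarrow> f x > 1 - \<epsilon>"
proof (rule ccontr)
  assume no: "\<not> thesis"
  have "\<exists>x. norm x \<le> 1 \<and> norm (u + x) > 2 - 1 / Suc n \<and> f x \<le> 1 - \<epsilon>" for n
    using no that[of "1 / Suc n"] by (force simp: not_less)
  then obtain xs where xs: "\<And>n. norm (xs n) \<le> 1" "\<And>n. norm (u + xs n) > 2 - 1 / Suc n" "\<And>n. f (xs n) \<le> 1 - \<epsilon>"
    by metis
  have "(\<lambda>n. norm (u + xs n)) \<longlonglongrightarrow> 2"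
  proof (rule tendsto_sandwich[OF always_eventually always_eventually])
    show "\<forall>n. 2 - 1 / Suc n \<le> norm (u + xs n)" using xs(2) less_imp_le by blast
    show "\<forall>n. norm (u + xs n) \<le> 2"
      using norm_triangle_ineq[of u] xs(1) norm_u by (smt (verit))
    show "(\<lambda>n. 2 - 1 / Suc n) \<longlonglongrightarrow> (2::real)"
      using tendsto_diff[OF tendsto_const LIMSEQ_inverse_real_of_nat, of 2] by (simp add: divide_inverse)
  qed simp
  then have "(\<lambda>n. f (xs n)) \<longlonglongrightarrow> 1" using det xs(1) by blast
  then have "1 \<le> 1 - \<epsilon>" by (rule LIMSEQ_le_const2) (use xs(3) in blast)
  then show False using \<epsilon> by simp
qed

end

text \<open>The bound \<eta> does not depend on \<open>g\<close> and \<open>z\<close>, so it serves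
  all isometries through \<open>g = f \<circ> inv T\<close> and \<open>z = T u\<close>. A common
  near-maximiser \<open>z\<close> pushes the norm of the sum of the functionals towards 2.\<close>

lemma dual_wstar_LUR_uniform:
  fixes x :: "'a::real_normed_vector"
  assumes lur: "dual_wstar_LUR TYPE('a)" and k: "supports k x" and x: "norm x = 1" and \<epsilon>: "\<epsilon> > 0"
  obtains \<eta> where "\<eta> > 0"
    "\<And>g z. linear g \<Longrightarrow> (\<And>v. g v \<le> norm v) \<Longrightarrow> norm z \<le> 1 \<Longrightarrow> g z + k z > 2 - \<eta> \<Longrightarrow> \<bar>g y - k y\<bar> < \<epsilon>"
proof (rule ccontr)
  assume no: "\<not> thesis"
  have "\<exists>g z. linear g \<and> (\<forall>v. g v \<le> norm v) \<and> norm z \<le> 1 \<and> g z + k z > 2 - 1 / Suc n \<and> \<bar>g y - k y\<bar> \<ge> \<epsilon>" for n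
    using no that[of "1 / Suc n"] by (force simp: not_less)
  then obtain g z where g: "\<And>n. linear (g n)" "\<And>n v. g n v \<le> norm v" and z: "\<And>n. norm (z n) \<le> 1"
    and gz: "\<And>n. g n (z n) + k (z n) > 2 - 1 / Suc n" and far: "\<And>n. \<bar>g n y - k y\<bar> \<ge> \<epsilon>"
    by metis
  have bg: "bounded_linear (g n)" for n using functional_bounded_linear g by blast
  have bk: "bounded_linear k" using functional_bounded_linear supports_linear[OF k] supports_le[OF k] by blast
  define F where "F = Blinfun k"
  define Gs where "Gs n = Blinfun (g n)" for n
  have F: "blinfun_apply F v = k v" and G: "blinfun_apply (Gs n) v = g n v" for n v
    using bk bg by (simp_all add: F_def Gs_def bounded_linear_Blinfun_apply)
  have abs: "\<bar>h v\<bar> \<le> norm v" if "linear h" "\<And>v. h v \<le> norm v" for h :: "'a \<Rightarrow> real" and v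
    using that(2)[of v] that(2)[of "- v"] linear_neg[OF that(1), of v] by simp
  have "norm F \<le> 1" by (rule norm_blinfun_bound) (use supports_abs[OF k] in \<open>simp_all add: F\<close>)
  moreover have "norm F \<ge> 1" using norm_blinfun[of F x] x supports_self[OF k] by (simp add: F)
  ultimately have nF: "norm F = 1" by simp
  have nG: "norm (Gs n) \<le> 1" for n
    by (rule norm_blinfun_bound) (use abs[OF g] in \<open>simp_all add: G\<close>)
  have "(\<lambda>n. norm (F + Gs n)) \<longlonglongrightarrow> 2"
  proof (rule tendsto_sandwich[OF always_eventually always_eventually])
    have "2 - 1 / Suc n \<le> norm (F + Gs n)" for n
    proof -
      have "2 - 1 / Suc n \<le> blinfun_apply (F + Gs n) (z n)"
        using gz[of n] by (simp add: blinfun.add_left F G)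
      also have "\<dots> \<le> norm (F + Gs n) * norm (z n)"
        using norm_blinfun[of "F + Gs n" "z n"] by simp
      also have "\<dots> \<le> norm (F + Gs n) * 1" using z by (intro mult_left_mono) auto
      finally show ?thesis by simp
    qed
    then show "\<forall>n. 2 - 1 / Suc n \<le> norm (F + Gs n)" by blast
    show "\<forall>n. norm (F + Gs n) \<le> 2"
      using norm_triangle_ineq[of F] nF nG by (smt (verit))
    show "(\<lambda>n. 2 - 1 / Suc n) \<longlonglongrightarrow> (2::real)"
      using tendsto_diff[OF tendsto_const LIMSEQ_inverse_real_of_nat, of 2] by (simp add: divide_inverse)
  qed simp
  then have "(\<lambda>n. blinfun_apply (Gs n) y) \<longlonglongrightarrow> blinfun_apply F y"
    using lur nF nG unfolding dual_wstar_LUR_def by blast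
  then have "(\<lambda>n. \<bar>g n y - k y\<bar>) \<longlonglongrightarrow> \<bar>k y - k y\<bar>"
    unfolding F G by (intro tendsto_intros)
  then have "\<epsilon> \<le> \<bar>k y - k y\<bar>" by (rule LIMSEQ_le_const) (use far in blast)
  then show False using \<epsilon> by simp
qed

text \<open>For a unit vector \<open>x\<close> convexity makes this infimum the limit as
  \<open>s\<close> decreases to 0; as an infimum it gives a lower bound valid for every
  \<open>s > 0\<close>.\<close>

definition right_derivative :: "'a::real_normed_vector \<Rightarrow> 'a \<Rightarrow> real" where
  "right_derivative x y = (INF s\<in>{0<..}. (norm (x + s *\<^sub>R y) - 1) / s)"

lemma right_derivative_le:
  assumes x: "norm x = 1" and s: "s > 0"
  shows "1 + s * right_derivative x y \<le> norm (x + s *\<^sub>R y)"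
proof -
  have "bdd_below ((\<lambda>s. (norm (x + s *\<^sub>R y) - 1) / s) ` {0<..})"
  proof (rule bdd_belowI2)
    fix t :: real assume "t \<in> {0<..}"
    then show "- norm y \<le> (norm (x + t *\<^sub>R y) - 1) / t"
      using norm_diff_ineq[of x "t *\<^sub>R y"] x by (simp add: field_simps)
  qed
  then have "right_derivative x y \<le> (norm (x + s *\<^sub>R y) - 1) / s"
    unfolding right_derivative_def using s by (intro cINF_lower) auto
  then show ?thesis using s by (simp add: field_simps)
qed

lemma right_derivative_greatest:
  assumes "\<And>s. s > 0 \<Longrightarrow> 1 + s * c \<le> norm (x + s *\<^sub>R y)"
  shows "c \<le> right_derivative x y"
  unfolding right_derivative_def
proof (rule cINF_greatest)
  fix s :: real assume "s \<in> {0<..}"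
  then show "c \<le> (norm (x + s *\<^sub>R y) - 1) / s"
    using assms[of s] by (simp add: field_simps)
qed simp

text \<open>A bound at one parameter \<open>r\<close> passes to all smaller ones by convexity, since
  \<open>x + s y\<close> lies between \<open>x\<close> and \<open>x + r y\<close>.\<close>

lemma right_derivative_approx:
  assumes x: "norm x = 1" and \<epsilon>: "\<epsilon> > 0"
  obtains r where "r > 0" "\<And>s. 0 < s \<Longrightarrow> s \<le> r \<Longrightarrow> norm (x + s *\<^sub>R y) \<le> 1 + s * (right_derivative x y + \<epsilon>)"
proof -
  have "\<not> right_derivative x y + \<epsilon> \<le> right_derivative x y" using \<epsilon> by simp
  then obtain r where r: "r > 0" "norm (x + r *\<^sub>R y) < 1 + r * (right_derivative x y + \<epsilon>)"
    using right_derivative_greatest[of "right_derivative x y + \<epsilon>" x y] by (force simp: not_le)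
  have "norm (x + s *\<^sub>R y) \<le> 1 + s * (right_derivative x y + \<epsilon>)" if s: "0 < s" "s \<le> r" for s
  proof -
    define w where "w = s / r"
    have w: "0 \<le> w" "w \<le> 1" "s = w * r" using s r by (auto simp: w_def)
    have "x + s *\<^sub>R y = (1 - w) *\<^sub>R x + w *\<^sub>R (x + r *\<^sub>R y)" using w(3) by (simp add: algebra_simps)
    then have "norm (x + s *\<^sub>R y) \<le> norm ((1 - w) *\<^sub>R x) + norm (w *\<^sub>R (x + r *\<^sub>R y))"
      by (metis norm_triangle_ineq)
    also have "\<dots> = (1 - w) + w * norm (x + r *\<^sub>R y)" using w x by simp
    also have "\<dots> \<le> (1 - w) + w * (1 + r * (right_derivative x y + \<epsilon>))"
      using w r by (intro add_left_mono mult_left_mono) auto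
    also have "\<dots> = 1 + s * (right_derivative x y + \<epsilon>)" using w(3) by (simp add: algebra_simps)
    finally show ?thesis .
  qed
  then show thesis using that r(1) by blast
qed

section \<open>Contractive complementary projections at arbitrary unit vectors\<close>

context big_point_functional
begin

text \<open>Close to x in direction y, every functional of the orbit that nearly supports takes a value
  on y close to the right derivative of the norm; so the averaging lemma applies there.\<close>
lemma complement_right_derivative_le:
  fixes x y :: 'a
  assumes det: "\<And>\<epsilon>. \<epsilon> > 0 \<Longrightarrow> \<exists>\<eta>>0. \<forall>x. norm x \<le> 1 \<longrightarrow> norm (u + x) > 2 - \<eta> \<longrightarrow> f x > 1 - \<epsilon>"
    and x: "norm x = 1"
  shows "norm (y - right_derivative x y *\<^sub>R x) \<le> norm y"
proof (rule field_le_epsilon)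
  fix e :: real assume "e > 0"
  \<comment> \<open>Three errors \<open>\<epsilon> * s\<close> meet in the upper bound for
    \<open>s * f (inv T y)\<close>: one from detection, two from the norm of
    \<open>x + 2 s y\<close>.\<close>
  define \<epsilon> where "\<epsilon> = e / 3"
  have \<epsilon>: "\<epsilon> > 0" using \<open>e > 0\<close> by (simp add: \<epsilon>_def)
  define c where "c = right_derivative x y"
  obtain r where r: "r > 0" "\<And>s. 0 < s \<Longrightarrow> s \<le> r \<Longrightarrow> norm (x + s *\<^sub>R y) \<le> 1 + s * (c + \<epsilon>)"
    using right_derivative_approx[OF x \<epsilon>, of y] unfolding c_def by blast
  have main: "norm (y - (c / norm (x + s *\<^sub>R y)) *\<^sub>R (x + s *\<^sub>R y)) \<le> norm y + e"
    if s: "0 < s" "s \<le> r / 2" and nz: "x + s *\<^sub>R y \<noteq> 0" for s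
  proof -
    define n where "n = norm (x + s *\<^sub>R y)"
    define x' where "x' = (1 / n) *\<^sub>R (x + s *\<^sub>R y)"
    have n: "n > 0" using nz by (simp add: n_def)
    have x': "norm x' = 1" using n by (simp add: x'_def) (simp add: n_def)
    obtain k where k: "supports k x'" by (rule supports_exists)
    \<comment> \<open>The accuracy is proportional to \<open>s\<close> because the estimates are
      finally divided by \<open>s\<close>.\<close>
    obtain \<eta> where \<eta>: "\<eta> > 0" "\<And>x. norm x \<le> 1 \<Longrightarrow> norm (u + x) > 2 - \<eta> \<Longrightarrow> f x > 1 - \<epsilon> * s / n"
      using det[of "\<epsilon> * s / n"] \<epsilon> s n by auto
    have "norm (y - c *\<^sub>R x') \<le> norm y + e"
    proof (rule averaged_projection[OF k x' \<eta>(1)])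
      fix T assume T: "T \<in> surj_lin_isometries" and kT: "k (T u) > 1 - \<eta>"
      note T' = isometry_inv[OF T]
      note lin = isometry_linear[OF T']
      have "2 - \<eta> < k (T u + x')"
        using kT supports_self[OF k] x' by (simp add: linear_add[OF supports_linear[OF k]])
      also have "\<dots> \<le> norm (T u + x')" by (rule supports_le[OF k])
      also have "\<dots> = norm (u + inv T x')"
        using isometry_norm[OF T', of "T u + x'"] by (simp add: linear_add[OF lin] isometry_inv_left[OF T])
      finally have "f (inv T x') > 1 - \<epsilon> * s / n"
        using \<eta>(2)[of "inv T x'"] isometry_norm[OF T', of x'] x' by simp
      moreover have "f (inv T x') = f (inv T (x + s *\<^sub>R y)) / n"
        by (simp add: x'_def linear_scale[OF lin] f_simps)
      ultimately have "n * (1 - \<epsilon> * s / n) < n * (f (inv T (x + s *\<^sub>R y)) / n)"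
        using n by (intro mult_strict_left_mono) simp_all
      then have fx: "f (inv T (x + s *\<^sub>R y)) > n - \<epsilon> * s"
        using n by (simp add: right_diff_distrib)
      have lower: "n - \<epsilon> * s - 1 < s * f (inv T y)"
        using fx f_inv_abs_le[OF T, of x] x by (simp add: linear_add[OF lin] linear_scale[OF lin] f_simps)
      \<comment> \<open>Going on to \<open>x + 2 s y\<close> bounds \<open>f (inv T y)\<close> from
        above, as going back to \<open>x\<close> bounded it from below.\<close>
      have "f (inv T (x + s *\<^sub>R y)) + s * f (inv T y) = f (inv T (x + (2 * s) *\<^sub>R y))"
        by (simp add: linear_add[OF lin] linear_scale[OF lin] f_simps)
      also have "\<dots> \<le> 1 + (2 * s) * (c + \<epsilon>)"
        using f_inv_abs_le[OF T, of "x + (2 * s) *\<^sub>R y"] r(2)[of "2 * s"] s by simp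
      finally have upper: "s * f (inv T y) < 1 + 2 * s * (c + \<epsilon>) - n + \<epsilon> * s"
        using fx by simp
      have "1 + s * c \<le> n" using right_derivative_le[OF x s(1), of y] by (simp add: c_def n_def)
      then have "s * (c - e) \<le> s * f (inv T y)" "s * f (inv T y) \<le> s * (c + e)"
        using lower upper \<epsilon> s by (auto simp: \<epsilon>_def algebra_simps)
      then show "\<bar>f (inv T y) - c\<bar> \<le> e" using s by simp
    qed (use \<open>e > 0\<close> in simp)
    then show ?thesis by (simp add: x'_def n_def)
  qed
  have lim: "((\<lambda>s. x + s *\<^sub>R y) \<longlongrightarrow> x) (at_right 0)"
  proof -
    have "((\<lambda>s. x + s *\<^sub>R y) \<longlongrightarrow> x + 0 *\<^sub>R y) (at_right 0)"
      by (intro tendsto_intros)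
    then show ?thesis by simp
  qed
  have "x \<noteq> 0" using x by auto
  show "norm (y - right_derivative x y *\<^sub>R x) \<le> norm y + e"
  proof (rule tendsto_upperbound)
    show "((\<lambda>s. norm (y - (c / norm (x + s *\<^sub>R y)) *\<^sub>R (x + s *\<^sub>R y)))
        \<longlongrightarrow> norm (y - right_derivative x y *\<^sub>R x)) (at_right 0)"
    proof -
      have "((\<lambda>s. norm (y - (c / norm (x + s *\<^sub>R y)) *\<^sub>R (x + s *\<^sub>R y)))
          \<longlongrightarrow> norm (y - (c / norm x) *\<^sub>R x)) (at_right 0)"
        by (intro tendsto_intros lim) (use x in simp)
      then show ?thesis using x by (simp add: c_def)
    qed
    have "\<forall>\<^sub>F s in at_right 0. s \<in> {0<..<r/2}"
      using r(1) by (intro eventually_at_right_real) auto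
    moreover have "\<forall>\<^sub>F s in at_right 0. x + s *\<^sub>R y \<noteq> 0"
      using tendsto_imp_eventually_ne[OF lim \<open>x \<noteq> 0\<close>] .
    ultimately show "\<forall>\<^sub>F s in at_right 0. norm (y - (c / norm (x + s *\<^sub>R y)) *\<^sub>R (x + s *\<^sub>R y)) \<le> norm y + e"
      by eventually_elim (use main in auto)
  qed simp
qed

text \<open>The admissible coefficients \<open>t\<close>, those with
  \<open>norm (y - t *\<^sub>R x) \<le> norm y\<close>, form an interval. It contains both one-sided
  derivatives, and \<open>k y\<close> lies between these.\<close>

lemma complement_le_of_detection:
  fixes x y :: 'a
  assumes det: "\<And>\<epsilon>. \<epsilon> > 0 \<Longrightarrow> \<exists>\<eta>>0. \<forall>x. norm x \<le> 1 \<longrightarrow> norm (u + x) > 2 - \<eta> \<longrightarrow> f x > 1 - \<epsilon>"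
    and x: "norm x = 1" and k: "supports k x"
  shows "norm (y - k y *\<^sub>R x) \<le> norm y"
proof -
  note lk = supports_linear[OF k]
  have le: "k v \<le> right_derivative x v" for v
  proof (rule right_derivative_greatest)
    show "1 + s * k v \<le> norm (x + s *\<^sub>R v)" for s
      using supports_le[OF k, of "x + s *\<^sub>R v"] supports_self[OF k] x
      by (simp add: linear_add[OF lk] linear_scale[OF lk])
  qed
  define S where "S = {t. norm (y - t *\<^sub>R x) \<le> norm y}"
  have "convex S"
    unfolding convex_def
  proof (intro ballI allI impI)
    fix p q v w :: real
    assume pq: "p \<in> S" "q \<in> S" and vw: "0 \<le> v" "0 \<le> w" "v + w = 1"
    have "y - (v * p + w * q) *\<^sub>R x = (v + w) *\<^sub>R y - (v * p + w * q) *\<^sub>R x" using vw by simp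
    also have "\<dots> = v *\<^sub>R (y - p *\<^sub>R x) + w *\<^sub>R (y - q *\<^sub>R x)" by (simp add: algebra_simps)
    finally have "norm (y - (v * p + w * q) *\<^sub>R x) \<le> v * norm (y - p *\<^sub>R x) + w * norm (y - q *\<^sub>R x)"
      using vw norm_triangle_ineq[of "v *\<^sub>R (y - p *\<^sub>R x)" "w *\<^sub>R (y - q *\<^sub>R x)"] by simp
    also have "\<dots> \<le> v * norm y + w * norm y"
      using pq vw by (intro add_mono mult_left_mono) (auto simp: S_def)
    also have "\<dots> = norm y" using vw by (simp flip: distrib_right)
    finally show "v *\<^sub>R p + w *\<^sub>R q \<in> S" by (simp add: S_def)
  qed
  then have int: "is_interval S" by (simp add: is_interval_convex_1)
  have 1: "right_derivative x y \<in> S"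
    using complement_right_derivative_le[OF det x] by (simp add: S_def)
  have "norm (y + right_derivative x (- y) *\<^sub>R x) = norm (- y - right_derivative x (- y) *\<^sub>R x)"
    using norm_minus_cancel[of "y + right_derivative x (- y) *\<^sub>R x"] by simp
  then have 2: "- right_derivative x (- y) \<in> S"
    using complement_right_derivative_le[OF det x, of "- y"] by (simp add: S_def)
  have "- right_derivative x (- y) \<le> k y" using le[of "- y"] by (simp add: linear_neg[OF lk])
  then have "k y \<in> S" using mem_is_interval_1_I[OF int 2 1] le by blast
  then show ?thesis by (simp add: S_def)
qed

text \<open>The functional \<open>f \<circ> inv T\<close> is 1 at \<open>T u\<close>, where
  \<open>k\<close> is almost 1; (b) then puts \<open>f (inv T y)\<close> close to
  \<open>k y\<close>, as \<open>averaged_projection\<close> requires.\<close>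

lemma complement_le_of_LUR:
  fixes x y :: 'a
  assumes lur: "dual_wstar_LUR TYPE('a)" and x: "norm x = 1" and k: "supports k x"
  shows "norm (y - k y *\<^sub>R x) \<le> norm y"
proof (rule field_le_epsilon)
  fix e :: real assume e: "e > 0"
  obtain \<eta> where \<eta>: "\<eta> > 0"
    "\<And>g z. linear g \<Longrightarrow> (\<And>v. g v \<le> norm v) \<Longrightarrow> norm z \<le> 1 \<Longrightarrow> g z + k z > 2 - \<eta> \<Longrightarrow> \<bar>g y - k y\<bar> < e"
    using dual_wstar_LUR_uniform[OF lur k x e, where y = y] by blast
  show "norm (y - k y *\<^sub>R x) \<le> norm y + e"
  proof (rule averaged_projection[OF k x \<eta>(1)])
    fix T assume T: "T \<in> surj_lin_isometries" and kT: "k (T u) > 1 - \<eta>"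
    have "\<bar>f (inv T y) - k y\<bar> < e"
    proof (rule \<eta>(2)[of "\<lambda>v. f (inv T v)" "T u"])
      show "linear (\<lambda>v. f (inv T v))"
        using linear_compose[OF isometry_linear[OF isometry_inv[OF T]] linear_f] by (simp add: o_def)
      show "f (inv T v) \<le> norm v" for v using f_inv_abs_le[OF T, of v] by simp
    qed (use kT norm_orbit[OF T] in \<open>simp_all add: isometry_inv_left[OF T] f_u\<close>)
    then show "\<bar>f (inv T y) - k y\<bar> \<le> e" by simp
  qed (use e in simp)
qed

end

lemma symmetric_orthogonalityI:
  assumes "\<And>k (x::'a::real_normed_vector) y. norm x = 1 \<Longrightarrow> supports k x \<Longrightarrow> norm (y - k y *\<^sub>R x) \<le> norm y"
  shows "symmetric_orthogonality TYPE('a)"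
  unfolding symmetric_orthogonality_def
proof (intro allI impI)
  fix k :: "'a \<Rightarrow> real" and x y t
  assume k: "supports k x" and ky: "k y = 0"
  note lk = supports_linear[OF k]
  show "norm y \<le> norm (y + t *\<^sub>R x)"
  proof (cases "x = 0")
    case False
    define x' where "x' = (1 / norm x) *\<^sub>R x"
    have "supports k x'" unfolding x'_def by (rule supports_scale[OF k]) simp
    moreover have "norm x' = 1" using False by (simp add: x'_def)
    ultimately have "norm ((y + t *\<^sub>R x) - k (y + t *\<^sub>R x) *\<^sub>R x') \<le> norm (y + t *\<^sub>R x)"
      by (rule assms[rotated])
    moreover have "k (y + t *\<^sub>R x) *\<^sub>R x' = t *\<^sub>R x"
      using False supports_self[OF k] ky by (simp add: x'_def linear_add[OF lk] linear_scale[OF lk])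
    ultimately show ?thesis by simp
  qed simp
qed

section \<open>The planar case\<close>

definition positive_form :: "('a::real_vector \<Rightarrow> 'a \<Rightarrow> real) \<Rightarrow> bool" where
  "positive_form A \<longleftrightarrow> (\<forall>x. linear (A x)) \<and> (\<forall>x y. A x y = A y x) \<and> (\<forall>x. x \<noteq> 0 \<longrightarrow> A x x > 0)"

text \<open>Strict log-concavity of the determinant on positive definite forms. Multiplying by
  \<open>a * a'\<close> and eliminating \<open>c\<close> and \<open>c'\<close> leaves two squares
  with positive weights whose sum is at most 0.\<close>

lemma maximal_determinant_unique:
  fixes a b c a' b' c' D :: real
  assumes D: "D > 0" "a * c - b\<^sup>2 = D" "a' * c' - b'\<^sup>2 = D" and pos: "a > 0" "a' > 0"
    and le: "(a + a') * (c + c') - (b + b')\<^sup>2 \<le> 4 * D"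
  shows "a' = a \<and> b' = b \<and> c' = c"
proof -
  have c: "a * c = D + b\<^sup>2" and c': "a' * c' = D + b'\<^sup>2" using D by simp_all
  have "a * c' + a' * c - 2 * b * b' \<le> 2 * D"
    using le D(2,3) by (simp add: algebra_simps power2_eq_square)
  then have "a * a' * (a * c' + a' * c - 2 * b * b') \<le> a * a' * (2 * D)"
    using pos by (intro mult_left_mono) auto
  moreover have "a * a' * (a * c' + a' * c - 2 * b * b') = a\<^sup>2 * (a' * c') + a'\<^sup>2 * (a * c) - 2 * a * a' * b * b'"
    by (simp add: algebra_simps power2_eq_square)
  ultimately have *: "D * (a - a')\<^sup>2 + (a * b' - a' * b)\<^sup>2 \<le> 0"
    unfolding c c' by (simp add: algebra_simps power2_eq_square)
  have "D * (a - a')\<^sup>2 \<ge> 0" using D(1) by simp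
  then have "D * (a - a')\<^sup>2 = 0" "(a * b' - a' * b)\<^sup>2 = 0"
    using * zero_le_power2[of "a * b' - a' * b"] by linarith+
  then have "a' = a" "b' = b" using D(1) pos by auto
  moreover have "a * c' = a * c" using c c' \<open>a' = a\<close> \<open>b' = b\<close> by simp
  ultimately show ?thesis using pos by simp
qed

text \<open>The form of maximal determinant among those dominated by the squared norm is unique, hence
  invariant; its unit ellipse is the ellipse of minimal area around the unit ball.\<close>
lemma invariant_form_exists:
  fixes \<alpha> \<beta> :: "'a::real_normed_vector \<Rightarrow> real"
  assumes lin: "linear \<alpha>" "linear \<beta>"
    and coord: "\<And>x. x = \<alpha> x *\<^sub>R u + \<beta> x *\<^sub>R e"
    and basis: "\<alpha> u = 1" "\<beta> u = 0" "\<alpha> e = 0" "\<beta> e = 1"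
    and le: "\<And>x. \<bar>\<alpha> x\<bar> \<le> norm x" "\<And>x. \<bar>\<beta> x\<bar> \<le> norm x"
  obtains A :: "'a \<Rightarrow> 'a \<Rightarrow> real" where "positive_form A" "\<And>T x. T \<in> surj_lin_isometries \<Longrightarrow> A (T x) (T x) = A x x"
    "continuous_on UNIV (\<lambda>x. A x x)"
proof -
  note l = linear_add[OF lin(1)] linear_scale[OF lin(1)] linear_add[OF lin(2)] linear_scale[OF lin(2)]
  define Q where "Q = (\<lambda>(a, b, c) x. a * (\<alpha> x)\<^sup>2 + 2 * b * \<alpha> x * \<beta> x + c * (\<beta> x)\<^sup>2)"
  define K where "K = {p. \<forall>x. 0 \<le> Q p x \<and> Q p x \<le> (norm x)\<^sup>2}"
  define det :: "real \<times> real \<times> real \<Rightarrow> real" where "det = (\<lambda>(a, b, c). a * c - b\<^sup>2)"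
  have closed: "closed K"
  proof -
    have "closed {p. 0 \<le> Q p x \<and> Q p x \<le> (norm x)\<^sup>2}" for x
      unfolding Q_def split_beta by (intro closed_Collect_conj closed_Collect_le continuous_intros)
    then show ?thesis unfolding K_def by (intro closed_Collect_all) auto
  qed
  define M where "M = (norm u)\<^sup>2 + (norm e)\<^sup>2 + (norm (u + e))\<^sup>2"
  have "K \<subseteq> {-M..M} \<times> {-M..M} \<times> {-M..M}"
  proof
    fix p assume p: "p \<in> K"
    obtain a b c where abc: "p = (a, b, c)" by (cases p)
    have K: "0 \<le> Q p x" "Q p x \<le> (norm x)\<^sup>2" for x using p by (auto simp: K_def)
    have "0 \<le> a" "a \<le> (norm u)\<^sup>2" "0 \<le> c" "c \<le> (norm e)\<^sup>2"
      using K[of u] K[of e] by (simp_all add: Q_def abc basis)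
    moreover have "0 \<le> a + 2 * b + c" "a + 2 * b + c \<le> (norm (u + e))\<^sup>2"
      using K[of "u + e"] by (simp_all add: Q_def abc basis l)
    moreover have "(norm u)\<^sup>2 \<ge> 0" "(norm e)\<^sup>2 \<ge> 0" "(norm (u + e))\<^sup>2 \<ge> 0" by auto
    ultimately show "p \<in> {-M..M} \<times> {-M..M} \<times> {-M..M}" unfolding abc M_def by auto
  qed
  then have "compact K"
    using closed compact_Int_closed[of "{-M..M} \<times> {-M..M} \<times> {-M..M}" K]
    by (simp add: compact_Times Int_absorb1)
  \<comment> \<open>An admissible form of determinant 1/4, so the maximum is positive.\<close>
  moreover have half: "(1/2, 0, 1/2) \<in> K"
  proof -
    have "(\<alpha> x)\<^sup>2 \<le> (norm x)\<^sup>2" "(\<beta> x)\<^sup>2 \<le> (norm x)\<^sup>2" for x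
      using le[of x] by (simp_all add: abs_le_square_iff[symmetric])
    then have "(\<alpha> x)\<^sup>2 / 2 + (\<beta> x)\<^sup>2 / 2 \<le> (norm x)\<^sup>2" for x
      using add_mono[of "(\<alpha> x)\<^sup>2" "(norm x)\<^sup>2" "(\<beta> x)\<^sup>2" "(norm x)\<^sup>2"] by simp
    then show ?thesis by (auto simp: K_def Q_def)
  qed
  moreover have "continuous_on K det"
    unfolding det_def split_beta by (intro continuous_intros)
  ultimately obtain p where p: "p \<in> K" and max: "\<And>q. q \<in> K \<Longrightarrow> det q \<le> det p"
    using continuous_attains_sup[of K det] by blast
  obtain a b c where abc: "p = (a, b, c)" by (cases p)
  define D where "D = a * c - b\<^sup>2"
  have D: "D > 0" using max[OF half] by (simp add: det_def abc D_def)
  have Qe: "Q (a, b, c) x = a * (\<alpha> x)\<^sup>2 + 2 * b * \<alpha> x * \<beta> x + c * (\<beta> x)\<^sup>2" for a b c x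
    by (simp add: Q_def)
  have apos: "a' > 0" if "(a', b', c') \<in> K" "a' * c' - b'\<^sup>2 > 0" for a' b' c'
  proof -
    have "0 \<le> Q (a', b', c') u" using that(1) unfolding K_def by blast
    then have "a' \<ge> 0" by (simp add: Qe basis)
    moreover have "a' \<noteq> 0" using that(2) zero_le_power2[of b'] by auto
    ultimately show ?thesis by simp
  qed
  have a: "a > 0" using apos[of a b c] p D by (simp add: abc D_def)
  have coordT: "\<alpha> (T x) = \<alpha> x * \<alpha> (T u) + \<beta> x * \<alpha> (T e)" "\<beta> (T x) = \<alpha> x * \<beta> (T u) + \<beta> x * \<beta> (T e)"
    if "linear T" for T x
  proof -
    have "T x = \<alpha> x *\<^sub>R T u + \<beta> x *\<^sub>R T e"
      using coord[of x] linear_add[OF that] linear_scale[OF that] by metis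
    then show "\<alpha> (T x) = \<alpha> x * \<alpha> (T u) + \<beta> x * \<alpha> (T e)" "\<beta> (T x) = \<alpha> x * \<beta> (T u) + \<beta> x * \<beta> (T e)"
      by (simp_all add: l)
  qed
  \<comment> \<open>\<open>d T\<close> is the determinant of \<open>T\<close> in the basis
    \<open>u\<close>, \<open>e\<close>, and \<open>tr T\<close> the coefficients of the form pulled
    back along \<open>T\<close>.\<close>
  define d where "d T = \<alpha> (T u) * \<beta> (T e) - \<alpha> (T e) * \<beta> (T u)" for T
  define tr where "tr T = (Q p (T u), a * \<alpha> (T u) * \<alpha> (T e) + b * (\<alpha> (T u) * \<beta> (T e) + \<alpha> (T e) * \<beta> (T u)) + c * \<beta> (T u) * \<beta> (T e), Q p (T e))" for T
  have Qtr: "Q (tr T) x = Q p (T x)" if "linear T" for T x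
    unfolding tr_def abc Qe coordT[OF that, of x] by (simp add: algebra_simps power2_eq_square)
  have trK: "tr T \<in> K" if "T \<in> surj_lin_isometries" for T
  proof -
    have "0 \<le> Q p (T x) \<and> Q p (T x) \<le> (norm (T x))\<^sup>2" for x using p unfolding K_def by blast
    then show ?thesis using that by (simp add: K_def Qtr isometry_linear isometry_norm)
  qed
  have dtr: "det (tr T) = D * (d T)\<^sup>2" for T
    unfolding tr_def abc Qe det_def D_def d_def by (simp add: algebra_simps power2_eq_square)
  have d_le: "(d T)\<^sup>2 \<le> 1" if "T \<in> surj_lin_isometries" for T
    using max[OF trK[OF that]] D unfolding dtr by (simp add: det_def abc D_def[symmetric])
  have inv: "Q p (T x) = Q p x" if T: "T \<in> surj_lin_isometries" for T x
  proof -
    note T' = isometry_inv[OF T]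
    note ct = coordT[OF isometry_linear[OF T'], of "T u"] coordT[OF isometry_linear[OF T'], of "T e"]
    \<comment> \<open>Neither \<open>T\<close> nor its inverse can raise the maximal determinant, so
      both preserve it and the pulled-back form is a maximiser too.\<close>
    have "d T * d (inv T) = 1"
    proof -
      have "d T * d (inv T) = \<alpha> (inv T (T u)) * \<beta> (inv T (T e)) - \<alpha> (inv T (T e)) * \<beta> (inv T (T u))"
        unfolding ct d_def by (simp add: algebra_simps)
      then show ?thesis by (simp add: isometry_inv_left[OF T] basis)
    qed
    then have "(d T)\<^sup>2 * (d (inv T))\<^sup>2 = 1" by (metis power_mult_distrib power_one)
    moreover have "(d T)\<^sup>2 * (d (inv T))\<^sup>2 \<le> (d T)\<^sup>2 * 1"
      using d_le[OF T'] by (intro mult_left_mono) auto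
    ultimately have "(d T)\<^sup>2 = 1" using d_le[OF T] by simp
    then have dD: "det (tr T) = D" by (simp add: dtr)
    obtain a' b' c' where tr: "tr T = (a', b', c')" by (cases "tr T")
    have D': "a' * c' - b'\<^sup>2 = D" using dD by (simp add: tr det_def)
    have "((a + a') / 2, (b + b') / 2, (c + c') / 2) \<in> K"
    proof -
      have "0 \<le> Q ((a + a') / 2, (b + b') / 2, (c + c') / 2) x \<and>
          Q ((a + a') / 2, (b + b') / 2, (c + c') / 2) x \<le> (norm x)\<^sup>2" for x
      proof -
        have "Q ((a + a') / 2, (b + b') / 2, (c + c') / 2) x = (Q (a, b, c) x + Q (a', b', c') x) / 2"
          by (simp add: Qe field_simps)
        moreover have "0 \<le> Q (a, b, c) x" "Q (a, b, c) x \<le> (norm x)\<^sup>2"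
          "0 \<le> Q (a', b', c') x" "Q (a', b', c') x \<le> (norm x)\<^sup>2"
          using p trK[OF T] unfolding abc tr K_def by auto
        ultimately show ?thesis by simp
      qed
      then show ?thesis unfolding K_def by blast
    qed
    from max[OF this] have "((a + a') / 2) * ((c + c') / 2) - ((b + b') / 2)\<^sup>2 \<le> D"
      by (simp add: det_def abc D_def)
    moreover have "((a + a') / 2) * ((c + c') / 2) - ((b + b') / 2)\<^sup>2 = ((a + a') * (c + c') - (b + b')\<^sup>2) / 4"
      by (simp add: power2_eq_square field_simps)
    ultimately have le4: "(a + a') * (c + c') - (b + b')\<^sup>2 \<le> 4 * D" by simp
    have "a' > 0" using apos[of a' b' c'] trK[OF T] tr D' D by simp
    from maximal_determinant_unique[OF D D_def[symmetric] D' a this le4]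
    have "tr T = p" unfolding tr abc by blast
    then show ?thesis using Qtr[OF isometry_linear[OF T], of x] by simp
  qed
  define A where "A x y = a * \<alpha> x * \<alpha> y + b * (\<alpha> x * \<beta> y + \<beta> x * \<alpha> y) + c * \<beta> x * \<beta> y" for x y
  have AQ: "A x x = Q p x" for x by (simp add: A_def abc Qe power2_eq_square)
  have "positive_form A"
    unfolding positive_form_def
  proof (intro conjI allI impI)
    show "linear (A x)" for x by (rule linearI) (simp_all add: A_def l algebra_simps)
    show "A x y = A y x" for x y by (simp add: A_def algebra_simps)
    fix x :: 'a assume "x \<noteq> 0"
    have eq: "a * A x x = (a * \<alpha> x + b * \<beta> x)\<^sup>2 + D * (\<beta> x)\<^sup>2"
      by (simp add: A_def D_def power2_eq_square algebra_simps)
    have "(a * \<alpha> x + b * \<beta> x)\<^sup>2 + D * (\<beta> x)\<^sup>2 > 0"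
    proof (cases "\<beta> x = 0")
      case True
      then have "\<alpha> x \<noteq> 0" using coord[of x] \<open>x \<noteq> 0\<close> by auto
      then show ?thesis using True a by simp
    next
      case False
      then show ?thesis using D by (simp add: add_nonneg_pos)
    qed
    then show "A x x > 0" using zero_less_mult_pos[OF _ a] unfolding eq[symmetric] by blast
  qed
  moreover have "A (T x) (T x) = A x x" if "T \<in> surj_lin_isometries" for T x
    using inv[OF that] by (simp add: AQ)
  moreover have "continuous_on UNIV (\<lambda>x. A x x)"
  proof -
    have "bounded_linear \<alpha>" "bounded_linear \<beta>"
      using functional_bounded_linear[OF lin(1)] functional_bounded_linear[OF lin(2)] le abs_le_D1 by blast+
    then show ?thesis unfolding A_def by (intro continuous_intros linear_continuous_on)
  qed
  ultimately show thesis using that[of A] by blast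
qed

section \<open>The invariant form compared with the norm\<close>

lemma norm_from_positive_form:
  fixes A :: "'a::real_normed_vector \<Rightarrow> 'a \<Rightarrow> real"
  assumes "positive_form A" "\<And>x. A x x = (norm x)\<^sup>2"
  shows "norm_from_inner_product TYPE('a)"
proof -
  have lin: "linear (A x)" and sym: "A x y = A y x" for x y using assms(1) by (auto simp: positive_form_def)
  show ?thesis unfolding norm_from_inner_product_def
  proof (intro exI[of _ A] conjI allI)
    show "A (x + y) z = A x z + A y z" for x y z
      using linear_add[OF lin, of z x y] by (simp add: sym[of _ z])
    show "A (r *\<^sub>R x) y = r * A x y" for r x y
      using linear_scale[OF lin, of y r x] by (simp add: sym[of _ y])
  qed (use sym assms(2) in auto)
qed

text \<open>The choice \<open>e = 0\<close> covers dimension one. Otherwise a vector of the kernel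
  of \<open>f\<close> off the line of \<open>e\<close> would complete an independent triple.\<close>

lemma planar_coordinates:
  fixes f :: "'a::real_vector \<Rightarrow> real"
  assumes f: "linear f" "f u = 1" and dim: "\<not> three_dimensional TYPE('a)"
  obtains e where "f e = 0" "\<And>x. \<exists>b. x = f x *\<^sub>R u + b *\<^sub>R e"
proof (cases "\<exists>e. e \<noteq> 0 \<and> f e = 0")
  case False
  then have "x = f x *\<^sub>R u + 0 *\<^sub>R 0" for x
  proof -
    have "f (x - f x *\<^sub>R u) = 0" using f by (simp add: linear_diff linear_scale)
    then have "x - f x *\<^sub>R u = 0" using False by blast
    then show ?thesis by simp
  qed
  then show thesis using that[of 0] linear_0[OF f(1)] by blast
next
  case True
  then obtain e where e: "e \<noteq> 0" "f e = 0" by blast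
  have "\<exists>b. x = f x *\<^sub>R u + b *\<^sub>R e" for x
  proof (rule ccontr)
    assume no: "\<not> ?thesis"
    define v where "v = x - f x *\<^sub>R u"
    have fv: "f v = 0" using f by (simp add: v_def linear_diff linear_scale)
    have v: "v \<notin> span {e}"
    proof
      assume "v \<in> span {e}"
      then obtain b where "v = b *\<^sub>R e" by (auto simp: span_singleton)
      then show False using no by (auto simp: v_def algebra_simps)
    qed
    have "span {v, e} \<subseteq> {y. f y = 0}"
    proof (rule span_minimal)
      show "subspace {y. f y = 0}" using linear_subspace_kernel[OF f(1)] .
    qed (use e fv in auto)
    then have u: "u \<notin> span {v, e}" using f(2) by auto
    have "independent {v, e}" using v e(1) by (simp add: independent_insert)
    then have "independent {u, v, e}" using u by (auto simp: independent_insert intro: span_base)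
    moreover have "v \<noteq> e" using v span_base by blast
    moreover have "u \<noteq> v" "u \<noteq> e" using u span_base by blast+
    ultimately show False using dim unfolding three_dimensional_def by (metis card_3_iff)
  qed
  then show thesis using that e by blast
qed

text \<open>\<open>A\<close> is scaled to be 1 at \<open>u\<close>, hence on its orbit.
  \<open>dense\<close> is a common consequence of (a) and (b); it bounds \<open>A\<close> from below
  as the big point bounds it from above.\<close>

locale planar_form = big_point_functional u f for u :: "'a::real_normed_vector" and f +
  fixes A :: "'a \<Rightarrow> 'a \<Rightarrow> real" and e :: 'a
  assumes form: "positive_form A" and A_u: "A u u = 1"
    and A_cont: "continuous_on UNIV (\<lambda>x. A x x)"
    and A_iso: "T \<in> surj_lin_isometries \<Longrightarrow> A (T x) (T x) = A x x"
    and f_e: "f e = 0" and e: "e \<noteq> 0" and coord: "\<exists>b. x = f x *\<^sub>R u + b *\<^sub>R e"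
    and dense: "norm x = 1 \<Longrightarrow> \<epsilon> > 0 \<Longrightarrow> \<exists>T\<in>surj_lin_isometries. f (T x) > 1 - \<epsilon>"
begin

lemma A_lin: "linear (A x)" and A_sym: "A x y = A y x" and A_pos: "x \<noteq> 0 \<Longrightarrow> A x x > 0"
  using form by (auto simp: positive_form_def)

lemma A_simps:
  "A x (y + z) = A x y + A x z" "A x (y - z) = A x y - A x z" "A x (c *\<^sub>R y) = c * A x y"
  "A (y + z) x = A y x + A z x" "A (y - z) x = A y x - A z x" "A (c *\<^sub>R y) x = c * A y x"
  "A x 0 = 0" "A 0 x = 0" "A x (- y) = - A x y" "A (- y) x = - A y x"
  using linear_add[OF A_lin] linear_diff[OF A_lin] linear_scale[OF A_lin] linear_0[OF A_lin] linear_neg[OF A_lin]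
  by (simp_all add: A_sym[of _ x])

lemma A_nonneg: "A x x \<ge> 0"
  using A_pos[of x] by (cases "x = 0") (auto simp: A_simps)

lemma A_iso':
  assumes "T \<in> surj_lin_isometries"
  shows "A (T x) (T y) = A x y"
  using A_iso[OF assms, of "x + y"] A_iso[OF assms, of x] A_iso[OF assms, of y]
  by (simp add: linear_add[OF isometry_linear[OF assms]] A_simps A_sym[of y x] A_sym[of "T y" "T x"])

lemma A_Cauchy_Schwarz: "(A x y)\<^sup>2 \<le> A x x * A y y"
proof (cases "y = 0")
  case False
  have "0 \<le> A (A y y *\<^sub>R x - A x y *\<^sub>R y) (A y y *\<^sub>R x - A x y *\<^sub>R y)" by (rule A_nonneg)
  also have "\<dots> = A y y * (A x x * A y y - (A x y)\<^sup>2)"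
    by (simp add: A_simps A_sym[of y x] power2_eq_square algebra_simps)
  finally show ?thesis using A_pos[OF False] by (simp add: zero_le_mult_iff)
qed (simp add: A_simps)

text \<open>The ellipse where \<open>A\<close> is at most 1 is closed and convex and contains the
  orbit of \<open>u\<close>, hence the unit ball.\<close>

lemma A_le_norm: "A x x \<le> (norm x)\<^sup>2"
proof (cases "x = 0")
  case False
  have "(1 / norm x) *\<^sub>R x \<in> {p. A p p \<le> 1}"
  proof (rule unit_ball_subset)
    show "closed {p. A p p \<le> 1}" by (intro closed_Collect_le A_cont continuous_on_const)
    show "convex {p. A p p \<le> 1}"
      unfolding convex_def
    proof (intro ballI allI impI)
      fix p q and v w :: real
      assume pq: "p \<in> {p. A p p \<le> 1}" "q \<in> {p. A p p \<le> 1}" and vw: "0 \<le> v" "0 \<le> w" "v + w = 1"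
      have "A (v *\<^sub>R p + w *\<^sub>R q) (v *\<^sub>R p + w *\<^sub>R q)
          = (v + w) * (v * A p p + w * A q q) - v * w * A (p - q) (p - q)"
        by (simp add: A_simps A_sym[of q p] algebra_simps)
      also have "\<dots> \<le> v * A p p + w * A q q" using vw A_nonneg[of "p - q"] by simp
      also have "\<dots> \<le> v * 1 + w * 1" using pq vw by (intro add_mono mult_left_mono) auto
      finally show "v *\<^sub>R p + w *\<^sub>R q \<in> {p. A p p \<le> 1}" using vw by simp
    qed
  qed (use False in \<open>auto simp: A_iso A_u\<close>)
  then show ?thesis using False by (simp add: A_simps field_simps power2_eq_square)
qed (simp add: A_simps)

text \<open>xi is the point of the line f = 1 closest to 0 in the form A.\<close>

definition \<xi> :: 'a where "\<xi> = u - (A u e / A e e) *\<^sub>R e"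
text \<open>This vector vanishes exactly when \<open>u\<close> is \<open>A\<close>-orthogonal to the
  kernel of \<open>f\<close>. In that case \<open>m = 1\<close> by \<open>m_y\<close>, and
  \<open>A_le_norm\<close> and \<open>A_ge_norm\<close> identify \<open>A\<close> with the squared
  norm.\<close>

definition y :: 'a where "y = u - \<xi>"
definition m :: real where "m = A \<xi> \<xi>"

lemma f_xi: "f \<xi> = 1" and f_y: "f y = 0"
  by (simp_all add: \<xi>_def y_def f_simps f_e f_u)

lemma A_xi_e: "A \<xi> e = 0"
  using A_pos[OF e] by (simp add: \<xi>_def A_simps)

lemma A_xi_y: "A \<xi> y = 0"
proof -
  have "y = (A u e / A e e) *\<^sub>R e" by (simp add: y_def \<xi>_def)
  then show ?thesis using A_xi_e by (simp add: A_simps)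
qed

text \<open>\<open>\<xi>\<close> is \<open>A\<close>-orthogonal to the kernel of \<open>f\<close>,
  so it represents \<open>f\<close> up to a factor, which is found at \<open>\<xi>\<close>
  itself.\<close>

lemma A_xi: "A \<xi> x = m * f x"
proof -
  obtain b where "x = f x *\<^sub>R u + b *\<^sub>R e" using coord by blast
  then have x: "x = f x *\<^sub>R \<xi> + (f x * (A u e / A e e) + b) *\<^sub>R e" by (simp add: \<xi>_def algebra_simps)
  show ?thesis by (subst x) (simp add: A_simps A_xi_e m_def)
qed

lemma m_pos: "m > 0"
  unfolding m_def using f_xi f_simps(5) by (intro A_pos) auto

lemma m_y: "m + A y y = 1"
proof -
  have "A u u = A (\<xi> + y) (\<xi> + y)" by (simp add: y_def)
  then show ?thesis using A_u by (simp add: A_simps A_xi_y A_sym[of y \<xi>] m_def)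
qed

lemma f_le_A: "m * (f x)\<^sup>2 \<le> A x x"
proof -
  have "m * (m * (f x)\<^sup>2) \<le> m * A x x"
    using A_Cauchy_Schwarz[of \<xi> x] by (simp add: A_xi f_xi power2_eq_square algebra_simps)
  then show ?thesis using m_pos by simp
qed

text \<open>By \<open>dense\<close> an isometry moves a unit vector to where \<open>f\<close> is
  almost 1; this leaves \<open>A\<close> unchanged, and there \<open>f_le_A\<close> applies.\<close>

lemma A_ge_norm: "m * (norm x)\<^sup>2 \<le> A x x"
proof (cases "x = 0")
  case False
  define x' where "x' = (1 / norm x) *\<^sub>R x"
  have x': "norm x' = 1" using False by (simp add: x'_def)
  have "m * (1 - \<epsilon>)\<^sup>2 \<le> A x' x'" if \<epsilon>: "\<epsilon> > 0" "\<epsilon> < 1" for \<epsilon>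
  proof -
    obtain T where T: "T \<in> surj_lin_isometries" "f (T x') > 1 - \<epsilon>" using dense[OF x' \<epsilon>(1)] by blast
    have "m * (1 - \<epsilon>)\<^sup>2 \<le> m * (f (T x'))\<^sup>2" using T \<epsilon> m_pos by (simp add: power_mono)
    also have "\<dots> \<le> A x' x'" using f_le_A[of "T x'"] by (simp add: A_iso T)
    finally show ?thesis .
  qed
  then have "\<forall>\<^sub>F \<epsilon> in at_right 0. m * (1 - \<epsilon>)\<^sup>2 \<le> A x' x'"
    using eventually_at_right_real[of 0 1] by (simp add: eventually_mono)
  moreover have "((\<lambda>\<epsilon>. m * (1 - \<epsilon>)\<^sup>2) \<longlongrightarrow> m * (1 - 0)\<^sup>2) (at_right 0)" by (intro tendsto_intros)
  ultimately have "m * (1 - 0)\<^sup>2 \<le> A x' x'" by (intro tendsto_upperbound[of _ _ "at_right 0"]) auto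
  then show ?thesis using False by (simp add: x'_def A_simps field_simps power2_eq_square)
qed (simp add: A_simps)

lemma inner_product_if: "y = 0 \<Longrightarrow> norm_from_inner_product TYPE('a)"
  using m_y A_le_norm A_ge_norm by (intro norm_from_positive_form[OF form]) (force simp: A_simps intro: order_antisym)

lemma supports_u: "supports f u" "supports (A u) u"
proof -
  show "supports f u" using linear_f f_u f_abs_le norm_u abs_le_D1 by (auto simp: supports_def)
  have "A u z \<le> norm z" for z
  proof (rule power2_le_imp_le[OF _ norm_ge_zero, THEN order_trans[OF abs_ge_self]])
    show "\<bar>A u z\<bar>\<^sup>2 \<le> (norm z)\<^sup>2"
      using A_Cauchy_Schwarz[of u z] A_le_norm[of z] A_u by simp
  qed
  then show "supports (A u) u" using A_u norm_u A_lin by (simp add: supports_def)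
qed

text \<open>Under (b) the norm is smooth at \<open>u\<close>, so the two functionals of
  \<open>supports_u\<close> coincide.\<close>

lemma inner_product_of_unique_support:
  assumes "A u = f" shows "norm_from_inner_product TYPE('a)"
proof -
  have "A u e = 0" using f_e by (simp add: assms)
  then show ?thesis by (intro inner_product_if) (simp add: y_def \<xi>_def)
qed

end

text \<open>Both functionals attain the value 1 at \<open>x\<close>, which serves as the common
  maximiser in the uniform form of (b).\<close>

lemma LUR_unique_support:
  fixes x :: "'a::real_normed_vector"
  assumes lur: "dual_wstar_LUR TYPE('a)" and x: "norm x = 1" and k: "supports k x" and g: "supports g x"
  shows "g = k"
proof
  fix y
  have "\<bar>g y - k y\<bar> < \<epsilon>" if \<epsilon>: "\<epsilon> > 0" for \<epsilon>
  proof -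
    obtain \<eta> where \<eta>: "\<eta> > 0"
      "\<And>g z. linear g \<Longrightarrow> (\<And>v. g v \<le> norm v) \<Longrightarrow> norm z \<le> 1 \<Longrightarrow> g z + k z > 2 - \<eta> \<Longrightarrow> \<bar>g y - k y\<bar> < \<epsilon>"
      using dual_wstar_LUR_uniform[OF lur k x \<epsilon>, where y = y] by blast
    show ?thesis using \<eta>(1) x supports_self[OF g] supports_self[OF k]
      by (intro \<eta>(2)[OF supports_linear[OF g] supports_le[OF g], of x]) auto
  qed
  then show "g y = k y" by (metis abs_le_zero_iff field_le_epsilon add_0 less_imp_le eq_iff_diff_eq_0)
qed

section \<open>Condition (a) in the plane\<close>

context planar_form
begin

text \<open>Transport by \<open>T n\<close> gives
  \<open>norm (u + inv (T n) x) = norm (T n u + x)\<close>, and \<open>g\<close>, being bounded by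
  the norm, certifies that this tends to 2.\<close>

lemma detected_pointwise:
  assumes det: "\<And>xs :: nat \<Rightarrow> 'a. (\<And>n. norm (xs n) \<le> 1) \<Longrightarrow> (\<lambda>n. norm (u + xs n)) \<longlonglongrightarrow> 2
            \<Longrightarrow> (\<lambda>n. f (xs n)) \<longlonglongrightarrow> 1"
    and T: "\<And>n. T n \<in> surj_lin_isometries" and x: "norm x \<le> 1"
    and g: "\<And>z. g z \<le> norm z" "(\<lambda>n. g (T n u + x)) \<longlonglongrightarrow> (2::real)"
  shows "(\<lambda>n. f (inv (T n) x)) \<longlonglongrightarrow> 1"
proof (rule det)
  note T' = isometry_inv[OF T]
  show "norm (inv (T n) x) \<le> 1" for n using x by (simp add: isometry_norm[OF T'])
  have eq: "norm (u + inv (T n) x) = norm (T n u + x)" for n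
    using isometry_norm[OF T', of n "T n u + x"]
    by (simp add: linear_add[OF isometry_linear[OF T']] isometry_inv_left[OF T])
  show "(\<lambda>n. norm (u + inv (T n) x)) \<longlonglongrightarrow> 2"
    unfolding eq
  proof (rule tendsto_sandwich[OF always_eventually always_eventually g(2)])
    show "\<forall>n. norm (T n u + x) \<le> 2"
      using norm_triangle_ineq[of "T _ u" x] norm_orbit[OF T] x by (smt (verit))
  qed (use g in simp_all)
qed

lemma f_inv: "T \<in> surj_lin_isometries \<Longrightarrow> m * f (inv T x) = A (T \<xi>) x"
  using A_iso'[of T \<xi> "inv T x"] by (simp add: A_xi isometry_inv_right)

lemma tendsto_of_form:
  assumes "(\<lambda>n. A (x n) (x n)) \<longlonglongrightarrow> 0" shows "x \<longlonglongrightarrow> 0"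
proof -
  have "(\<lambda>n. (norm (x n))\<^sup>2) \<longlonglongrightarrow> 0"
  proof (rule tendsto_sandwich[OF always_eventually always_eventually tendsto_const])
    show "\<forall>n. (norm (x n))\<^sup>2 \<le> A (x n) (x n) / m" using A_ge_norm m_pos by (simp add: field_simps)
    show "(\<lambda>n. A (x n) (x n) / m) \<longlonglongrightarrow> 0" using tendsto_divide[OF assms tendsto_const, of m] m_pos by simp
  qed simp
  then have "(\<lambda>n. sqrt ((norm (x n))\<^sup>2)) \<longlonglongrightarrow> sqrt 0" by (rule tendsto_real_sqrt)
  then have "(\<lambda>n. norm (x n)) \<longlonglongrightarrow> 0" by simp
  then show ?thesis by (simp add: tendsto_norm_zero_iff)
qed

lemma decomp:
  assumes "y \<noteq> 0" shows "x = f x *\<^sub>R \<xi> + (A y x / A y y) *\<^sub>R y"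
proof -
  define t where "t = A u e / A e e"
  have y: "y = t *\<^sub>R e" by (simp add: y_def \<xi>_def t_def)
  have t: "t \<noteq> 0" using assms y by auto
  obtain b where "x = f x *\<^sub>R u + b *\<^sub>R e" using coord by blast
  also have "\<dots> = f x *\<^sub>R \<xi> + (f x + b / t) *\<^sub>R y" using t by (simp add: y \<xi>_def t_def[symmetric] algebra_simps)
  finally have x: "x = f x *\<^sub>R \<xi> + (f x + b / t) *\<^sub>R y" .
  have "A y x = (f x + b / t) * A y y"
    by (subst x) (simp add: A_simps A_xi_y A_sym[of y \<xi>])
  then show ?thesis using x A_pos[OF assms] by simp
qed

lemma form_decomp:
  assumes "y \<noteq> 0" shows "A x x = m * (f x)\<^sup>2 + (A y x)\<^sup>2 / A y y"
proof -
  define t where "t = A y x / A y y"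
  have "A x x = A (f x *\<^sub>R \<xi> + t *\<^sub>R y) (f x *\<^sub>R \<xi> + t *\<^sub>R y)"
    unfolding t_def decomp[OF assms, of x, symmetric] ..
  also have "\<dots> = m * (f x)\<^sup>2 + t\<^sup>2 * A y y"
    by (simp add: A_simps A_xi_y A_sym[of y \<xi>] m_def power2_eq_square)
  also have "t\<^sup>2 * A y y = (A y x)\<^sup>2 / A y y"
    using A_pos[OF assms] by (simp add: t_def power2_eq_square)
  finally show ?thesis .
qed

text \<open>The functional f - eps A y attains 1 at xi, hence is almost attained at
  orbit points. These tend to the reflection xi - y of u, so that the reflection is a limit
  of isometries.\<close>
lemma reflection_isometric:
  assumes det: "\<And>xs :: nat \<Rightarrow> 'a. (\<And>n. norm (xs n) \<le> 1) \<Longrightarrow> (\<lambda>n. norm (u + xs n)) \<longlonglongrightarrow> 2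
            \<Longrightarrow> (\<lambda>n. f (xs n)) \<longlonglongrightarrow> 1"
    and y: "y \<noteq> 0"
  shows "norm (a *\<^sub>R \<xi> + b *\<^sub>R y) = norm (a *\<^sub>R \<xi> - b *\<^sub>R y)"
proof -
  have norm_xi: "norm \<xi> \<le> 1"
    using A_ge_norm[of \<xi>] m_pos by (simp add: m_def[symmetric] power_le_one_iff abs_square_le_1)
  define \<epsilon> :: "nat \<Rightarrow> real" where "\<epsilon> n = 1 / Suc n" for n
  have \<epsilon>: "\<epsilon> n > 0" "\<epsilon> n \<le> 1" for n by (simp_all add: \<epsilon>_def)
  have \<epsilon>0: "\<epsilon> \<longlonglongrightarrow> 0" using LIMSEQ_inverse_real_of_nat by (simp add: \<epsilon>_def[abs_def] divide_inverse)
  have A_y_le: "\<bar>A y z\<bar> \<le> norm z" for z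
  proof (rule power2_le_imp_le)
    have "(A y z)\<^sup>2 \<le> A y y * A z z" by (rule A_Cauchy_Schwarz)
    also have "\<dots> \<le> 1 * (norm z)\<^sup>2" using m_y m_pos A_nonneg A_le_norm by (intro mult_mono) auto
    finally show "\<bar>A y z\<bar>\<^sup>2 \<le> (norm z)\<^sup>2" by simp
  qed simp
  have bl: "bounded_linear f" "bounded_linear (A y)"
    using functional_bounded_linear[OF linear_f] functional_bounded_linear[OF A_lin, of y]
      f_abs_le A_y_le abs_le_D1 by blast+
  \<comment> \<open>The tolerance is the square of the perturbation: as
    \<open>f (T u) \<le> 1\<close>, it gives \<open>A y (T u) < \<epsilon> n\<close>. In the limit
    this rules out \<open>u\<close> itself, where \<open>A y u = A y y > 0\<close>, and selects the
    reflected point.\<close>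
  have "\<exists>T\<in>surj_lin_isometries. f (T u) - \<epsilon> n * A y (T u) > 1 - \<epsilon> n * \<epsilon> n" for n
  proof -
    have bl': "bounded_linear (\<lambda>z. f z - \<epsilon> n * A y z)"
      by (intro bounded_linear_sub bl bounded_linear_const_mult)
    have "f \<xi> - \<epsilon> n * A y \<xi> > 1 - \<epsilon> n * \<epsilon> n"
      using \<epsilon> by (simp add: f_xi A_xi_y A_sym[of y \<xi>])
    from orbit_exceeds[OF bl' norm_xi this] show ?thesis by blast
  qed
  then obtain T where T: "\<And>n. T n \<in> surj_lin_isometries"
    and fT: "\<And>n. f (T n u) - \<epsilon> n * A y (T n u) > 1 - \<epsilon> n * \<epsilon> n" by metis
  have fle: "f (T n u) \<le> 1" and Ale: "\<bar>A y (T n u)\<bar> \<le> 1" for n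
    using f_abs_le[of "T n u"] A_y_le[of "T n u"] norm_orbit[OF T, of n] by simp_all
  have "A y (T n u) < \<epsilon> n" for n
  proof -
    have "\<epsilon> n * A y (T n u) < \<epsilon> n * \<epsilon> n" using fT[of n] fle[of n] by simp
    then show ?thesis using \<epsilon> by simp
  qed
  have f1: "(\<lambda>n. f (T n u)) \<longlonglongrightarrow> 1"
  proof -
    have "1 - \<epsilon> n * \<epsilon> n - \<epsilon> n \<le> f (T n u)" for n
    proof -
      have "\<epsilon> n * A y (T n u) \<ge> \<epsilon> n * (-1)" using Ale[of n] \<epsilon>[of n] by (intro mult_left_mono) auto
      then show ?thesis using fT[of n] by simp
    qed
    moreover have "(\<lambda>n. 1 - \<epsilon> n * \<epsilon> n - \<epsilon> n) \<longlonglongrightarrow> 1 - 0 * 0 - 0"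
      by (intro tendsto_intros \<epsilon>0)
    ultimately show ?thesis
      using fle by (intro tendsto_sandwich[where g = "\<lambda>n. f (T n u)" and h = "\<lambda>n. 1"
        and f = "\<lambda>n. 1 - \<epsilon> n * \<epsilon> n - \<epsilon> n"]) auto
  qed
  \<comment> \<open>\<open>T n u\<close> stays on the unit ellipse, so \<open>f\<close> tending to 1
    fixes the absolute value of the other coordinate.\<close>
  have sq: "(A y (T n u))\<^sup>2 = A y y * (1 - m * (f (T n u))\<^sup>2)" for n
  proof -
    have "1 = A (T n u) (T n u)" by (simp add: A_iso[OF T] A_u)
    also have "\<dots> = m * (f (T n u))\<^sup>2 + (A y (T n u))\<^sup>2 / A y y"
      by (rule form_decomp[OF y])
    finally show ?thesis using A_pos[OF y] by (simp add: field_simps)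
  qed
  have A1: "(\<lambda>n. A y (T n u)) \<longlonglongrightarrow> - A y y"
  proof -
    have abs: "(\<lambda>n. \<bar>A y (T n u)\<bar>) \<longlonglongrightarrow> A y y"
    proof -
      have "(\<lambda>n. sqrt (A y y * (1 - m * (f (T n u))\<^sup>2))) \<longlonglongrightarrow> sqrt (A y y * (1 - m * 1\<^sup>2))"
        by (intro tendsto_intros f1)
      then have "(\<lambda>n. \<bar>A y (T n u)\<bar>) \<longlonglongrightarrow> sqrt (A y y * (1 - m * 1\<^sup>2))"
        unfolding sq[symmetric] real_sqrt_abs .
      moreover have "1 - m * 1\<^sup>2 = A y y" using m_y by simp
      ultimately show ?thesis using A_nonneg[of y] by simp
    qed
    show ?thesis
    proof (rule tendsto_sandwich[OF always_eventually always_eventually])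
      show "\<forall>n. - \<bar>A y (T n u)\<bar> \<le> A y (T n u)" by (simp add: abs_ge_minus_self minus_le_iff)
      show "\<forall>n. A y (T n u) \<le> 2 * \<epsilon> n - \<bar>A y (T n u)\<bar>"
        using \<open>\<And>n. A y (T n u) < \<epsilon> n\<close> \<epsilon>(1) by (smt (verit))
      show "(\<lambda>n. - \<bar>A y (T n u)\<bar>) \<longlonglongrightarrow> - A y y" by (intro tendsto_intros abs)
      show "(\<lambda>n. 2 * \<epsilon> n - \<bar>A y (T n u)\<bar>) \<longlonglongrightarrow> - A y y"
        by (rule tendsto_eq_intros abs \<epsilon>0 refl)+ simp
    qed
  qed
  \<comment> \<open>By \<open>f_inv\<close> this says that \<open>A (T n \<xi>) \<xi>\<close> tends
    to \<open>m = A \<xi> \<xi>\<close>, whence \<open>T n \<xi>\<close> tends to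
    \<open>\<xi>\<close>.\<close>
  have xi1: "(\<lambda>n. f (inv (T n) \<xi>)) \<longlonglongrightarrow> 1"
  proof (rule detected_pointwise[OF det T norm_xi])
    show "f z \<le> norm z" for z using f_abs_le[of z] by simp
    show "(\<lambda>n. f (T n u + \<xi>)) \<longlonglongrightarrow> 2"
      unfolding f_simps f_xi by (rule tendsto_eq_intros f1 refl)+ simp
  qed
  have x0: "(\<lambda>n. T n \<xi> - \<xi>) \<longlonglongrightarrow> 0"
  proof (rule tendsto_of_form)
    have "A (T n \<xi> - \<xi>) (T n \<xi> - \<xi>) = 2 * m - 2 * (m * f (inv (T n) \<xi>))" for n
      by (simp add: A_simps A_iso[OF T] f_inv[OF T] m_def[symmetric] A_sym[of \<xi> "T n \<xi>"])
    moreover have "(\<lambda>n. 2 * m - 2 * (m * f (inv (T n) \<xi>))) \<longlonglongrightarrow> 0"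
      by (rule tendsto_eq_intros xi1 refl)+ simp
    ultimately show "(\<lambda>n. A (T n \<xi> - \<xi>) (T n \<xi> - \<xi>)) \<longlonglongrightarrow> 0" by simp
  qed
  have y0: "(\<lambda>n. T n y + y) \<longlonglongrightarrow> 0"
  proof (rule tendsto_of_form)
    have "A (T n y + y) (T n y + y) = 2 * A y y + 2 * (A y (T n u) - A y (T n \<xi> - \<xi>))" for n
    proof -
      have "T n y = T n u - T n \<xi>" unfolding y_def by (rule linear_diff[OF isometry_linear[OF T]])
      then have "A y (T n y) = A y (T n u) - A y (T n \<xi> - \<xi>)"
        by (simp add: A_simps A_xi_y A_sym[of y \<xi>])
      then show ?thesis by (simp add: A_simps A_iso[OF T] A_sym[of "T n y" y])
    qed
    moreover have "(\<lambda>n. 2 * A y y + 2 * (A y (T n u) - A y (T n \<xi> - \<xi>))) \<longlonglongrightarrow> 2 * A y y + 2 * (- A y y - A y 0)"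
      by (intro tendsto_intros A1 bounded_linear.tendsto[OF bl(2)] x0)
    ultimately have "(\<lambda>n. A (T n y + y) (T n y + y)) \<longlonglongrightarrow> 2 * A y y + 2 * (- A y y - A y 0)"
      by simp
    then show "(\<lambda>n. A (T n y + y) (T n y + y)) \<longlonglongrightarrow> 0" by (simp only: A_simps(7)) simp
  qed
  have eq: "norm (a *\<^sub>R \<xi> + b *\<^sub>R y) = norm (a *\<^sub>R (T n \<xi> - \<xi>) + b *\<^sub>R (T n y + y) + (a *\<^sub>R \<xi> - b *\<^sub>R y))" for n
  proof -
    note lin = isometry_linear[OF T, of n]
    have "T n (a *\<^sub>R \<xi> + b *\<^sub>R y) = a *\<^sub>R (T n \<xi> - \<xi>) + b *\<^sub>R (T n y + y) + (a *\<^sub>R \<xi> - b *\<^sub>R y)"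
      by (simp add: linear_add[OF lin] linear_scale[OF lin] algebra_simps)
    then show ?thesis using isometry_norm[OF T, of n "a *\<^sub>R \<xi> + b *\<^sub>R y"] by simp
  qed
  have "(\<lambda>n. norm (a *\<^sub>R (T n \<xi> - \<xi>) + b *\<^sub>R (T n y + y) + (a *\<^sub>R \<xi> - b *\<^sub>R y)))
      \<longlonglongrightarrow> norm (a *\<^sub>R 0 + b *\<^sub>R 0 + (a *\<^sub>R \<xi> - b *\<^sub>R y))"
    by (intro tendsto_intros x0 y0)
  then have "(\<lambda>n. norm (a *\<^sub>R \<xi> + b *\<^sub>R y)) \<longlonglongrightarrow> norm (a *\<^sub>R \<xi> - b *\<^sub>R y)"
    by (simp flip: eq)
  then show ?thesis by (simp add: LIMSEQ_const_iff)
qed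

text \<open>\<open>complement_le\<close> and the reflection bound the norm below by
  \<open>cross\<close>, a weighted sum of absolute coordinates. Hence the direction \<open>v\<close>
  of \<open>y\<close> is a limit of orbit points and lies on the unit circle and the ellipse. The
  functionals \<open>\<tau> + \<delta> f\<close> and \<open>\<tau> - \<delta> f\<close> are bounded
  by the norm and are 1 at \<open>v\<close>. By (a), applied at their further maximisers
  \<open>m v + \<delta> \<xi>\<close> and \<open>m v - \<delta> \<xi>\<close>, two limits equal 1,
  and their sum contradicts \<open>m < 1\<close>.\<close>

lemma detection_imp_y_eq_0:
  assumes det: "\<And>xs :: nat \<Rightarrow> 'a. (\<And>n. norm (xs n) \<le> 1) \<Longrightarrow> (\<lambda>n. norm (u + xs n)) \<longlonglongrightarrow> 2
            \<Longrightarrow> (\<lambda>n. f (xs n)) \<longlonglongrightarrow> 1"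
  shows "y = 0"
proof (rule ccontr)
  assume y: "y \<noteq> 0"
  define \<delta> where "\<delta> = norm y"
  have \<delta>: "\<delta> > 0" using y by (simp add: \<delta>_def)
  have Ayy: "A y y > 0" by (rule A_pos[OF y])
  define \<tau> where "\<tau> z = A y z / A y y * \<delta>" for z
  have lin_\<tau>: "linear \<tau>" by (rule linearI) (simp_all add: \<tau>_def A_simps add_divide_distrib distrib_right)
  \<comment> \<open>In these coordinates \<open>z - f z u\<close> is \<open>(b - a) y\<close>. The
    reflection changes the sign of \<open>b\<close>, and one of \<open>b - a\<close>,
    \<open>- b - a\<close> has absolute value \<open>\<bar>a\<bar> + \<bar>b\<bar>\<close>.\<close>
  have "\<bar>f z\<bar> * \<delta> + \<bar>\<tau> z\<bar> \<le> norm z" for z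
  proof -
    define a b where "a = f z" "b = A y z / A y y"
    have z: "z = a *\<^sub>R \<xi> + b *\<^sub>R y" using decomp[OF y, of z] by (simp add: a_b_def)
    have 1: "\<bar>b - a\<bar> * \<delta> \<le> norm (a *\<^sub>R \<xi> + b *\<^sub>R y)" for a b
    proof -
      have "a *\<^sub>R \<xi> + b *\<^sub>R y - f (a *\<^sub>R \<xi> + b *\<^sub>R y) *\<^sub>R u = (b - a) *\<^sub>R y"
        by (simp add: f_simps f_xi f_y) (simp add: y_def algebra_simps)
      then show ?thesis using complement_le[of "a *\<^sub>R \<xi> + b *\<^sub>R y"] by (simp add: \<delta>_def)
    qed
    have "\<bar>- b - a\<bar> * \<delta> \<le> norm z"
      using 1[of "- b" a] reflection_isometric[OF det y, of a b] z by simp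
    moreover have "\<bar>b - a\<bar> * \<delta> \<le> norm z" using 1[of b a] z by simp
    moreover have "\<bar>a\<bar> + \<bar>b\<bar> = \<bar>b - a\<bar> \<or> \<bar>a\<bar> + \<bar>b\<bar> = \<bar>- b - a\<bar>" by auto
    ultimately have "(\<bar>a\<bar> + \<bar>b\<bar>) * \<delta> \<le> norm z" by metis
    moreover have "\<bar>\<tau> z\<bar> = \<bar>b\<bar> * \<delta>" using \<delta> by (simp add: \<tau>_def a_b_def abs_mult)
    ultimately show ?thesis by (simp add: a_b_def algebra_simps)
  qed
  note cross = this
  define v where "v = (1 / \<delta>) *\<^sub>R y"
  have v: "norm v = 1" "\<tau> v = 1" "f v = 0" "A v v = A y y / \<delta>\<^sup>2" "A \<xi> v = 0"
    using \<delta> Ayy by (simp_all add: v_def \<tau>_def A_simps f_simps f_y A_xi_y power2_eq_square) (simp_all add: \<delta>_def)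
  have \<tau>_le: "\<tau> z \<le> norm z" for z using cross[of z] \<delta> by (smt (verit) mult_nonneg_nonneg)
  have "\<exists>T\<in>surj_lin_isometries. \<tau> (T u) > 1 - 1 / Suc n" for n
    using orbit_exceeds[OF functional_bounded_linear[OF lin_\<tau> \<tau>_le], of v "1 - 1 / Suc n"] v by (metis less_eq_real_def diff_less_eq less_add_same_cancel1 of_nat_0_less_iff zero_less_Suc zero_less_divide_1_iff)
  then obtain T where T: "\<And>n. T n \<in> surj_lin_isometries" and \<tau>T: "\<And>n. \<tau> (T n u) > 1 - 1 / Suc n"
    by metis
  have cross1: "\<bar>f (T n u)\<bar> * \<delta> + \<bar>\<tau> (T n u)\<bar> \<le> 1" for n using cross[of "T n u"] norm_orbit[OF T] by simp
  have lim: "(\<lambda>n. 1 - 1 / Suc n) \<longlonglongrightarrow> (1::real)"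
    using tendsto_diff[OF tendsto_const LIMSEQ_inverse_real_of_nat, of 1] by (simp add: divide_inverse)
  have \<tau>1: "(\<lambda>n. \<tau> (T n u)) \<longlonglongrightarrow> 1"
  proof (rule tendsto_sandwich[OF always_eventually always_eventually lim tendsto_const])
    show "\<forall>n. 1 - 1 / Suc n \<le> \<tau> (T n u)" using \<tau>T less_imp_le by blast
    show "\<forall>n. \<tau> (T n u) \<le> 1" using \<tau>_le norm_orbit[OF T] by metis
  qed
  have f0: "(\<lambda>n. f (T n u)) \<longlonglongrightarrow> 0"
  proof (rule Lim_null_comparison[OF always_eventually])
    show "\<forall>n. norm (f (T n u)) \<le> (1 - \<tau> (T n u)) / \<delta>"
      using cross1 \<delta> by (auto simp: field_simps) (smt (verit))
    show "(\<lambda>n. (1 - \<tau> (T n u)) / \<delta>) \<longlonglongrightarrow> 0"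
      using tendsto_divide[OF tendsto_diff[OF tendsto_const \<tau>1, of 1] tendsto_const, of \<delta>] \<delta> by simp
  qed
  \<comment> \<open>In the limit this becomes \<open>A v v = 1\<close>.\<close>
  have Q: "1 = m * (f (T n u))\<^sup>2 + (\<tau> (T n u))\<^sup>2 * (A y y / \<delta>\<^sup>2)" for n
  proof -
    have "1 = A (T n u) (T n u)" by (simp add: A_iso[OF T] A_u)
    also have "\<dots> = m * (f (T n u))\<^sup>2 + (A y (T n u))\<^sup>2 / A y y"
      by (rule form_decomp[OF y])
    also have "(A y (T n u))\<^sup>2 / A y y = (\<tau> (T n u))\<^sup>2 * (A y y / \<delta>\<^sup>2)"
      using Ayy \<delta> by (simp add: \<tau>_def power2_eq_square field_simps)
    finally show ?thesis .
  qed
  have "(\<lambda>n. m * (f (T n u))\<^sup>2 + (\<tau> (T n u))\<^sup>2 * (A y y / \<delta>\<^sup>2)) \<longlonglongrightarrow> m * 0\<^sup>2 + 1\<^sup>2 * (A y y / \<delta>\<^sup>2)"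
    by (intro tendsto_intros f0 \<tau>1)
  then have "(\<lambda>n. 1) \<longlonglongrightarrow> m * 0\<^sup>2 + 1\<^sup>2 * (A y y / \<delta>\<^sup>2)"
    unfolding Q[symmetric] .
  from LIMSEQ_unique[OF tendsto_const this] have "A y y = \<delta>\<^sup>2"
    using \<delta> by simp
  then have Ay: "A v v = 1" "A y y = \<delta>\<^sup>2" using v(4) \<delta> by simp_all
  have m\<delta>: "m + \<delta>\<^sup>2 = 1" using m_y Ay by simp
  have limit: "(\<lambda>n. f (inv (T n) (m *\<^sub>R v + (\<sigma> * \<delta>) *\<^sub>R \<xi>))) \<longlonglongrightarrow> 1" if \<sigma>: "\<sigma> * \<sigma> = 1" "\<bar>\<sigma>\<bar> = 1" for \<sigma> :: real
  proof (rule detected_pointwise[OF det T, where g = "\<lambda>z. \<tau> z + \<sigma> * \<delta> * f z"])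
    let ?x = "m *\<^sub>R v + (\<sigma> * \<delta>) *\<^sub>R \<xi>"
    have "A ?x ?x = m\<^sup>2 + (\<sigma> * \<sigma>) * \<delta>\<^sup>2 * m"
      by (simp add: A_simps v(5) A_sym[of v \<xi>] Ay m_def[symmetric] power2_eq_square)
    also have "\<dots> = m * (m + \<delta>\<^sup>2)" using \<sigma> by (simp add: power2_eq_square algebra_simps)
    finally have "m * (norm ?x)\<^sup>2 \<le> m * 1" using A_ge_norm[of ?x] m\<delta> by simp
    then show "norm ?x \<le> 1" using m_pos by (simp add: abs_square_le_1)
    show "\<tau> z + \<sigma> * \<delta> * f z \<le> norm z" for z
    proof -
      have "\<sigma> * \<delta> * f z \<le> \<bar>f z\<bar> * \<delta>" using \<sigma>(2) \<delta> abs_ge_self[of "\<sigma> * \<delta> * f z"] by (simp add: abs_mult mult.commute)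
      then show ?thesis using cross[of z] by linarith
    qed
    have x: "\<tau> ?x = m" "f ?x = \<sigma> * \<delta>"
      using v by (simp_all add: linear_add[OF lin_\<tau>] linear_scale[OF lin_\<tau>] f_simps f_xi) (simp add: \<tau>_def A_sym[of y \<xi>] A_xi_y)
    have "\<tau> (T n u + ?x) + \<sigma> * \<delta> * f (T n u + ?x) = \<tau> (T n u) + \<sigma> * \<delta> * f (T n u) + 1" for n
    proof -
      have "m + \<sigma> * \<delta> * (\<sigma> * \<delta>) = m + (\<sigma> * \<sigma>) * \<delta>\<^sup>2" by (simp add: power2_eq_square)
      also have "\<dots> = 1" using \<sigma> m\<delta> by simp
      finally show ?thesis using x by (simp add: linear_add[OF lin_\<tau>] linear_add[OF linear_f] distrib_left)
    qed
    moreover have "(\<lambda>n. \<tau> (T n u) + \<sigma> * \<delta> * f (T n u) + 1) \<longlonglongrightarrow> 1 + \<sigma> * \<delta> * 0 + 1"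
      by (intro tendsto_intros \<tau>1 f0)
    ultimately show "(\<lambda>n. \<tau> (T n u + ?x) + \<sigma> * \<delta> * f (T n u + ?x)) \<longlonglongrightarrow> 2" by simp
  qed
  \<comment> \<open>In the sum the multiples of \<open>\<xi>\<close> cancel, leaving
    \<open>2 * m * f (inv (T n) v)\<close>.\<close>
  have "(\<lambda>n. f (inv (T n) (m *\<^sub>R v + (1 * \<delta>) *\<^sub>R \<xi>)) + f (inv (T n) (m *\<^sub>R v + (-1 * \<delta>) *\<^sub>R \<xi>))) \<longlonglongrightarrow> 1 + 1"
    by (intro tendsto_add limit) simp_all
  moreover have "f (inv (T n) (m *\<^sub>R v + (1 * \<delta>) *\<^sub>R \<xi>)) + f (inv (T n) (m *\<^sub>R v + (-1 * \<delta>) *\<^sub>R \<xi>)) \<le> 2 * m" for n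
  proof -
    note lin = isometry_linear[OF isometry_inv[OF T], of n]
    have "f (inv (T n) (m *\<^sub>R v + (1 * \<delta>) *\<^sub>R \<xi>)) + f (inv (T n) (m *\<^sub>R v + (-1 * \<delta>) *\<^sub>R \<xi>)) = 2 * m * f (inv (T n) v)"
      by (simp add: linear_add[OF lin] linear_diff[OF lin] linear_scale[OF lin] f_simps)
    also have "\<dots> \<le> 2 * m * 1" using f_inv_abs_le[OF T, of n v] v m_pos by (intro mult_left_mono) auto
    finally show ?thesis by simp
  qed
  ultimately have "1 + 1 \<le> 2 * m" by (intro LIMSEQ_le_const2) auto
  moreover have "\<delta>\<^sup>2 > 0" using \<delta> by simp
  ultimately show False using m\<delta> by linarith
qed

end

section \<open>Conclusion in the plane and in general\<close>

lemma planar_inner_product: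
  fixes u :: "'a::real_normed_vector"
  assumes u: "big_point_functional u f" and dim: "\<not> three_dimensional TYPE('a)"
    and dense: "\<And>x \<epsilon>. norm x = 1 \<Longrightarrow> \<epsilon> > 0 \<Longrightarrow> \<exists>T\<in>surj_lin_isometries. f (T x) > 1 - \<epsilon>"
    and cond: "(\<forall>xs :: nat \<Rightarrow> 'a. (\<forall>n. norm (xs n) \<le> 1) \<longrightarrow> (\<lambda>n. norm (u + xs n)) \<longlonglongrightarrow> 2
        \<longrightarrow> (\<lambda>n. f (xs n)) \<longlonglongrightarrow> 1) \<or> dual_wstar_LUR TYPE('a)"
  shows "norm_from_inner_product TYPE('a)"
proof -
  interpret big_point_functional u f by (rule u)
  obtain e where e: "f e = 0" "\<And>x. \<exists>b. x = f x *\<^sub>R u + b *\<^sub>R e"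
    using planar_coordinates[OF linear_f f_u dim] by blast
  show ?thesis
  proof (cases "e = 0")
    case True
    then have x: "x = f x *\<^sub>R u" for x using e(2)[of x] by auto
    have "norm x = \<bar>f x\<bar>" for x by (subst x) (simp add: norm_u)
    then show ?thesis unfolding norm_from_inner_product_def
      by (intro exI[of _ "\<lambda>x y. f x * f y"]) (simp add: f_simps algebra_simps power2_eq_square[symmetric])
  next
    case False
    \<comment> \<open>With unit length, \<open>complement_le\<close> bounds the second coordinate by
      the norm.\<close>
    define e' where "e' = (1 / norm e) *\<^sub>R e"
    have e': "norm e' = 1" "e' \<noteq> 0" "f e' = 0" using False e by (auto simp: e'_def f_simps)
    have coord: "\<exists>b. x = f x *\<^sub>R u + b *\<^sub>R e'" for x
    proof -
      obtain b where "x = f x *\<^sub>R u + b *\<^sub>R e" using e(2) by blast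
      then have "x = f x *\<^sub>R u + (b * norm e) *\<^sub>R e'" using False by (simp add: e'_def)
      then show ?thesis by blast
    qed
    then obtain \<beta> where \<beta>: "\<And>x. x = f x *\<^sub>R u + \<beta> x *\<^sub>R e'" by metis
    have \<beta>_eq: "\<beta> x = b" if "x = f x *\<^sub>R u + b *\<^sub>R e'" for x b
      using \<beta>[of x] that e'(2) by (metis add_left_cancel scaleR_cancel_right)
    have "linear \<beta>"
    proof (rule linearI)
      fix x z c
      have "x + z = (f x *\<^sub>R u + \<beta> x *\<^sub>R e') + (f z *\<^sub>R u + \<beta> z *\<^sub>R e')"
        by (rule arg_cong2[OF \<beta> \<beta>])
      also have "\<dots> = f (x + z) *\<^sub>R u + (\<beta> x + \<beta> z) *\<^sub>R e'" by (simp add: f_simps algebra_simps)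
      finally show "\<beta> (x + z) = \<beta> x + \<beta> z" by (rule \<beta>_eq)
      have "c *\<^sub>R x = c *\<^sub>R (f x *\<^sub>R u + \<beta> x *\<^sub>R e')"
        by (rule arg_cong[OF \<beta>])
      also have "\<dots> = f (c *\<^sub>R x) *\<^sub>R u + (c *\<^sub>R \<beta> x) *\<^sub>R e'" by (simp add: f_simps algebra_simps)
      finally show "\<beta> (c *\<^sub>R x) = c *\<^sub>R \<beta> x" by (rule \<beta>_eq)
    qed
    have \<beta>_le: "\<bar>\<beta> x\<bar> \<le> norm x" for x
    proof -
      have "x - f x *\<^sub>R u = \<beta> x *\<^sub>R e'" by (subst (1) \<beta>[of x]) simp
      then show ?thesis using complement_le[of x] e'(1) by simp
    qed
    have basis: "f u = 1" "\<beta> u = 0" "f e' = 0" "\<beta> e' = 1"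
      using e' by (auto intro!: \<beta>_eq simp: f_u)
    obtain A0 :: "'a \<Rightarrow> 'a \<Rightarrow> real" where A0: "positive_form A0" "\<And>T x. T \<in> surj_lin_isometries \<Longrightarrow> A0 (T x) (T x) = A0 x x"
        "continuous_on UNIV (\<lambda>x. A0 x x)"
      using invariant_form_exists[OF linear_f \<open>linear \<beta>\<close> \<beta> basis f_abs_le \<beta>_le] by blast
    define A where "A x y = A0 x y / A0 u u" for x y
    have "u \<noteq> 0" using norm_u by auto
    then have A0u: "A0 u u > 0" using A0(1) by (simp add: positive_form_def)
    interpret planar_form u f A e'
    proof
      show "positive_form A" using A0(1) A0u
        by (auto simp: positive_form_def A_def linear_iff add_divide_distrib)
      show "A u u = 1" using A0u by (simp add: A_def)
      show "continuous_on UNIV (\<lambda>x. A x x)"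
        unfolding A_def by (intro continuous_intros A0(3)) (use A0u in auto)
    qed (use A0(2) e' coord dense in \<open>auto simp: A_def\<close>)
    from cond show ?thesis
    proof
      assume "dual_wstar_LUR TYPE('a)"
      then have "A u = f" using LUR_unique_support[OF _ norm_u supports_u] by blast
      then show ?thesis by (rule inner_product_of_unique_support)
    next
      assume "\<forall>xs :: nat \<Rightarrow> 'a. (\<forall>n. norm (xs n) \<le> 1) \<longrightarrow> (\<lambda>n. norm (u + xs n)) \<longlonglongrightarrow> 2
        \<longrightarrow> (\<lambda>n. f (xs n)) \<longlonglongrightarrow> 1"
      then show ?thesis by (intro inner_product_if detection_imp_y_eq_0) blast
    qed
  qed
qed

theorem theorem3p2:
  fixes u :: "'a::banach" and P :: "'a \<Rightarrow> 'a"
  assumes "big_point u"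
    and "bicontractive_projection P"
    and "range P = span {u}"
    and "(\<forall>xs :: nat \<Rightarrow> 'a. (\<forall>n. norm (xs n) \<le> 1) \<longrightarrow> (\<lambda>n. norm (u + xs n)) \<longlonglongrightarrow> 2
            \<longrightarrow> (\<lambda>n. P (xs n)) \<longlonglongrightarrow> u)
         \<or> dual_wstar_LUR TYPE('a)"
  shows "norm_from_inner_product TYPE('a)"
proof -
  have norm_u: "norm u = 1" using assms(1) by (simp add: big_point_def)
  then have u0: "u \<noteq> 0" by auto
  have P: "linear P" "P (P x) = P x" "norm (P x) \<le> norm x" "norm (x - P x) \<le> norm x" for x
    using assms(2) by (auto simp: bicontractive_projection_def)
  have "\<exists>c. P x = c *\<^sub>R u" for x
    using assms(3) by (auto simp: span_singleton)
  then obtain f where f: "\<And>x. P x = f x *\<^sub>R u" by metis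
  have f_eq: "f x = c" if "P x = c *\<^sub>R u" for x c using that u0 by (simp add: f)
  have "u \<in> range P" using assms(3) span_base by blast
  then have "P u = 1 *\<^sub>R u" using P(2) by auto
  then have f_u: "f u = 1" by (rule f_eq)
  have "linear f"
  proof (rule linearI; rule f_eq)
    show "P (x + y) = (f x + f y) *\<^sub>R u" for x y
      unfolding linear_add[OF P(1)] by (simp add: f scaleR_add_left)
    show "P (c *\<^sub>R x) = (c *\<^sub>R f x) *\<^sub>R u" for c x
      unfolding linear_scale[OF P(1)] by (simp add: f)
  qed
  moreover have "\<bar>f x\<bar> \<le> norm x" for x using P(3)[of x] norm_u by (simp add: f)
  moreover have "norm (x - f x *\<^sub>R u) \<le> norm x" for x using P(4)[of x] by (simp only: f)
  ultimately interpret big_point_functional u f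
    using assms(1) f_u by (intro big_point_functional.intro)
  have cond: "(\<forall>xs :: nat \<Rightarrow> 'a. (\<forall>n. norm (xs n) \<le> 1) \<longrightarrow> (\<lambda>n. norm (u + xs n)) \<longlonglongrightarrow> 2
        \<longrightarrow> (\<lambda>n. f (xs n)) \<longlonglongrightarrow> 1) \<or> dual_wstar_LUR TYPE('a)"
    using assms(4)
  proof (elim disj_forward all_forward imp_forward)
    fix xs :: "nat \<Rightarrow> 'a"
    have "bounded_linear f"
      using functional_bounded_linear[OF linear_f] f_abs_le abs_le_D1 by blast
    moreover assume "(\<lambda>n. P (xs n)) \<longlonglongrightarrow> u"
    ultimately have "(\<lambda>n. f (P (xs n))) \<longlonglongrightarrow> f u" by (rule bounded_linear.tendsto)
    then show "(\<lambda>n. f (xs n)) \<longlonglongrightarrow> 1" by (simp add: f f_simps f_u)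
  qed
  \<comment> \<open>Each assumption yields both facts: the bound behind symmetric orthogonality, and
    the near attainment of \<open>f\<close> on every orbit that the planar case uses.\<close>
  have "(\<forall>(x :: 'a) k. norm x = 1 \<longrightarrow> supports k x \<longrightarrow> (\<forall>y. norm (y - k y *\<^sub>R x) \<le> norm y)) \<and>
    (\<forall>x \<epsilon>. norm x = 1 \<longrightarrow> \<epsilon> > 0 \<longrightarrow> (\<exists>T\<in>surj_lin_isometries. f (T x) > 1 - \<epsilon>))"
    using cond
  proof
    assume lur: "dual_wstar_LUR TYPE('a)"
    have "\<exists>T\<in>surj_lin_isometries. f (T x) > 1 - \<epsilon>" if x: "norm x = 1" and \<epsilon>: "\<epsilon> > 0" for x \<epsilon>
    proof -
      obtain k where k: "supports k x" by (rule supports_exists)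
      obtain \<eta> where \<eta>: "\<eta> > 0"
        "\<And>g z. linear g \<Longrightarrow> (\<And>v. g v \<le> norm v) \<Longrightarrow> norm z \<le> 1 \<Longrightarrow> g z + k z > 2 - \<eta> \<Longrightarrow> \<bar>g x - k x\<bar> < \<epsilon>"
        using dual_wstar_LUR_uniform[OF lur k x \<epsilon>, where y = x] by blast
      obtain T where T: "T \<in> surj_lin_isometries" "k (T u) > 1 - \<eta>"
        using orbit_exceeds[OF functional_bounded_linear[OF supports_linear[OF k] supports_le[OF k]], of x "1 - \<eta>"]
          x \<eta>(1) supports_self[OF k] by auto
      \<comment> \<open>Here (b) acts on \<open>f \<circ> inv T\<close> and \<open>k\<close> at the
        common near-maximiser \<open>T u\<close>; as \<open>k x = 1\<close>, the isometry sought is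
        \<open>inv T\<close>.\<close>
      have "\<bar>f (inv T x) - k x\<bar> < \<epsilon>"
      proof (rule \<eta>(2)[of "\<lambda>v. f (inv T v)" "T u"])
        show "linear (\<lambda>v. f (inv T v))"
          using linear_compose[OF isometry_linear[OF isometry_inv[OF T(1)]] linear_f] by (simp add: o_def)
        show "f (inv T v) \<le> norm v" for v using f_inv_abs_le[OF T(1), of v] by simp
      qed (use T norm_orbit[OF T(1)] in \<open>simp_all add: isometry_inv_left[OF T(1)] f_u\<close>)
      then show ?thesis using isometry_inv[OF T(1)] supports_self[OF k] x by (intro bexI[of _ "inv T"]) auto
    qed
    then show ?thesis using complement_le_of_LUR[OF lur] by blast
  next
    assume a: "\<forall>xs :: nat \<Rightarrow> 'a. (\<forall>n. norm (xs n) \<le> 1) \<longrightarrow> (\<lambda>n. norm (u + xs n)) \<longlonglongrightarrow> 2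
        \<longrightarrow> (\<lambda>n. f (xs n)) \<longlonglongrightarrow> 1"
    have a': "(\<lambda>n. f (xs n)) \<longlonglongrightarrow> 1"
      if "\<And>n. norm (xs n) \<le> 1" "(\<lambda>n. norm (u + xs n)) \<longlonglongrightarrow> 2" for xs :: "nat \<Rightarrow> 'a"
      using a that by blast
    have det: "\<exists>\<eta>>0. \<forall>x. norm x \<le> 1 \<longrightarrow> norm (u + x) > 2 - \<eta> \<longrightarrow> f x > 1 - \<epsilon>" if \<epsilon>: "\<epsilon> > 0" for \<epsilon>
    proof -
      obtain \<eta> where "\<eta> > 0" "\<And>x. norm x \<le> 1 \<Longrightarrow> norm (u + x) > 2 - \<eta> \<Longrightarrow> f x > 1 - \<epsilon>"
        by (rule uniform_detection[OF _ \<epsilon>], rule a', blast, blast, blast)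
      then show ?thesis by blast
    qed
    have "\<exists>T\<in>surj_lin_isometries. f (T x) > 1 - \<epsilon>" if x: "norm x = 1" and \<epsilon>: "\<epsilon> > 0" for x \<epsilon>
    proof -
      obtain k where k: "supports k x" by (rule supports_exists)
      obtain \<eta> where \<eta>: "\<eta> > 0" "\<And>x. norm x \<le> 1 \<Longrightarrow> norm (u + x) > 2 - \<eta> \<Longrightarrow> f x > 1 - \<epsilon>"
        using det[OF \<epsilon>] by blast
      obtain T where T: "T \<in> surj_lin_isometries" "k (T u) > 1 - \<eta>"
        using orbit_exceeds[OF functional_bounded_linear[OF supports_linear[OF k] supports_le[OF k]], of x "1 - \<eta>"]
          x \<eta>(1) supports_self[OF k] by auto
      note T' = isometry_inv[OF T(1)]
      \<comment> \<open>\<open>k\<close> shows that \<open>T u + x\<close> has norm almost 2;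
        \<open>inv T\<close> moves it to \<open>u + inv T x\<close>, where detection
        applies.\<close>
      have "2 - \<eta> < k (T u + x)"
        using T(2) supports_self[OF k] x by (simp add: linear_add[OF supports_linear[OF k]])
      also have "\<dots> \<le> norm (inv T (T u + x))" using supports_le[OF k] by (simp add: isometry_norm[OF T'])
      also have "inv T (T u + x) = u + inv T x"
        by (simp add: linear_add[OF isometry_linear[OF T']] isometry_inv_left[OF T(1)])
      finally have "f (inv T x) > 1 - \<epsilon>" using \<eta>(2)[of "inv T x"] x by (simp add: isometry_norm[OF T'])
      then show ?thesis using T' by blast
    qed
    then show ?thesis using complement_le_of_detection[OF det] by blast
  qed
  then have compl: "\<And>k (x :: 'a) y. norm x = 1 \<Longrightarrow> supports k x \<Longrightarrow> norm (y - k y *\<^sub>R x) \<le> norm y"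
    and dense: "\<And>x \<epsilon>. norm x = 1 \<Longrightarrow> \<epsilon> > 0 \<Longrightarrow> \<exists>T\<in>surj_lin_isometries. f (T x) > 1 - \<epsilon>"
    by blast+
  show ?thesis
  proof (cases "three_dimensional TYPE('a)")
    case True
    then show ?thesis
      by (intro symmetric_orthogonality_inner_product symmetric_orthogonalityI compl)
  next
    case False
    then show ?thesis
      using planar_inner_product[OF big_point_functional_axioms _ dense cond] by blast
  qed
qed

end
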